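(* Let $\mathfrak b$ be the Hopf subalgebra of $\mathfrak u_{r,s}(G_2)$ generated by $e_i,\omega_i^{\pm1}$ ($i=1,2$), and let $t=\prod_{i=1}^2(1+\omega_i+\cdots+\omega_i^{\ell-1})$ and $x=E_2^{\ell-1}E_{12}^{\ell-1}E_{11212}^{\ell-1}E_{112}^{\ell-1}E_{1112}^{\ell-1}E_1^{\ell-1}$. Then $y=tx$ is a left integral in $\mathfrak b$ and $y'=xt$ is a right integral in $\mathfrak b$.
   Context: An element $y$ of a finite-dimensional Hopf algebra $H$ is a left (resp. right) integral if $ay=\varepsilon(a)y$ (resp. $ya=\varepsilon(a)y$) for all $a\in H$. $\mathbb{K}$ is a field of characteristic $0$; $r\in\mathbb K$ is a primitive $d$th root of unity, $s\in\mathbb K$ is a primitive $d'$th root of unity, $\ell=\mathrm{lcm}(d,d')$, $\mathbb K$ contains a primitive $\ell$th root of unity, and $\ell$ is coprime to $3$. It is assumed that $r^3\neq s^3$ and $r^4\neq s^4$. Put $r_1=r$, $s_1=s$, $r_2=r^3$, $s_2=s^3$, and $\langle\omega_1',\omega_1\rangle=rs^{-1}$, $\langle\omega_1',\omega_2\rangle=r^{-3}$, $\langle\omega_2',\omega_1\rangle=s^3$, $\langle\omega_2',\omega_2\rangle=r^3s^{-3}$. $U_{r,s}(G_2)$ is the unital associative $\mathbb{K}$-algebra generated by $e_i,f_i,\omega_i^{\pm1},\omega_i'^{\pm1}$ ($i=1,2$) with relations: (G1) all $\omega_i^{\pm1},\omega_j'^{\pm1}$ commute with each other, and $\omega_i\omega_i^{-1}=1=\omega_j'\omega_j'^{-1}$;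 (G2) $\omega_je_i\omega_j^{-1}=\langle\omega_i',\omega_j\rangle e_i$, $\omega_jf_i\omega_j^{-1}=\langle\omega_i',\omega_j\rangle^{-1}f_i$; (G3) $\omega_j'e_i\omega_j'^{-1}=\langle\omega_j',\omega_i\rangle^{-1}e_i$, $\omega_j'f_i\omega_j'^{-1}=\langle\omega_j',\omega_i\rangle f_i$; (G4) $e_if_j-f_je_i=\delta_{ij}\frac{\omega_i-\omega_i'}{r_i-s_i}$; (G5) $e_2^2e_1-(r^{-3}+s^{-3})e_2e_1e_2+(rs)^{-3}e_1e_2^2=0$ and $e_1^4e_2-(r+s)(r^2+s^2)e_1^3e_2e_1+rs(r^2+s^2)(r^2+rs+s^2)e_1^2e_2e_1^2-(rs)^3(r+s)(r^2+s^2)e_1e_2e_1^3+(rs)^6e_2e_1^4=0$; (G6) $f_1f_2^2-(r^{-3}+s^{-3})f_2f_1f_2+(rs)^{-3}f_2^2f_1=0$ and $f_2f_1^4-(r+s)(r^2+s^2)f_1f_2f_1^3+rs(r^2+s^2)(r^2+rs+s^2)f_1^2f_2f_1^2-(rs)^3(r+s)(r^2+s^2)f_1^3f_2f_1+(rs)^6f_1^4f_2=0$. It is a Hopf algebra in which $\omega_i^{\pm1},\omega_i'^{\pm1}$ are group-like, $\Delta(e_i)=e_i\otimes1+\omega_i\otimes e_i$, $\Delta(f_i)=1\otimes f_i+f_i\otimes\omega_i'$, $\varepsilon(e_i)=\varepsilon(f_i)=0$, $S(e_i)=-\omega_i^{-1}e_i$, $S(f_i)=-f_i\omega_i'^{-1}$.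 Quantum root vectors: $E_1=e_1$, $E_2=e_2$, $E_{12}=e_1e_2-s^3e_2e_1$, $E_{112}=e_1E_{12}-rs^2E_{12}e_1$, $E_{1112}=e_1E_{112}-r^2sE_{112}e_1$, $E_{11212}=E_{112}E_{12}-r^2sE_{12}E_{112}$; $F_1=f_1$, $F_2=f_2$, $F_{12}=f_2f_1-r^3f_1f_2$, $F_{112}=F_{12}f_1-r^2sf_1F_{12}$, $F_{1112}=F_{112}f_1-rs^2f_1F_{112}$, $F_{11212}=F_{12}F_{112}-rs^2F_{112}F_{12}$. $\mathfrak u_{r,s}(G_2)=U_{r,s}(G_2)/\mathcal I$, where $\mathcal I$ is the two-sided ideal generated by the $\ell$th powers of the twelve quantum root vectors $E_1,E_{1112},E_{112},E_{11212},E_{12},E_2,F_1,F_{1112},F_{112},F_{11212},F_{12},F_2$ and by $\omega_k^\ell-1$, $(\omega_k')^\ell-1$ ($k=1,2$), with the Hopf algebra structure induced from $U_{r,s}(G_2)$ (and the images of elements denoted by the same symbols). *)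

theory Defs
  imports
    "HOL-Library.Poly_Mapping"
    "HOL-Library.Product_Plus"
    "HOL-Algebra.QuotRing"
    "HOL-Algebra.Subrings"
    "HOL-Algebra.Generated_Groups"
begin

section \<open>Free algebras\<close>

text \<open>
  Words are written additively, so that the convolution product of \<^theory>\<open>HOL-Library.Poly_Mapping\<close>
  turns finitely supported functions on words into the free associative unital algebra.
\<close>

datatype 'g word = Word (letters: "'g list")

instantiation word :: (type) monoid_add
begin

definition zero_word :: "'a word" where
  "zero_word = Word []"

definition plus_word :: "'a word \<Rightarrow> 'a word \<Rightarrow> 'a word" where
  "plus_word u v = Word (letters u @ letters v)"

instance
  by standard (simp_all add: zero_word_def plus_word_def)

end

type_synonym ('g, 'k) free_alg = "'g word \<Rightarrow>\<^sub>0 'k"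

text \<open>
  The tensor square of the free algebra is the algebra of the product monoid:
  a basis is given by the tensors of two words.
\<close>

type_synonym ('g, 'k) free_alg2 = "('g word \<times> 'g word) \<Rightarrow>\<^sub>0 'k"

definition scalar :: "'k::zero \<Rightarrow> 'm::monoid_add \<Rightarrow>\<^sub>0 'k" where
  "scalar c = Poly_Mapping.single 0 c"

definition smul :: "'k::semiring_1 \<Rightarrow> ('m::monoid_add \<Rightarrow>\<^sub>0 'k) \<Rightarrow> ('m \<Rightarrow>\<^sub>0 'k)" (infixr "\<bullet>" 75) where
  "c \<bullet> a = scalar c * a"

definition gen :: "'g \<Rightarrow> ('g, 'k::semiring_1) free_alg" where
  "gen g = Poly_Mapping.single (Word [g]) 1"

definition tens :: "('g, 'k::semiring_1) free_alg \<Rightarrow> ('g, 'k) free_alg \<Rightarrow> ('g, 'k) free_alg2" where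
  "tens a b = (\<Sum>u\<in>Poly_Mapping.keys a. \<Sum>v\<in>Poly_Mapping.keys b.
     Poly_Mapping.single (u, v) (Poly_Mapping.lookup a u * Poly_Mapping.lookup b v))"

text \<open>
  Homomorphic and anti-homomorphic extension of a map on generators; \<open>\<eta>\<close> embeds the scalars
  into the target algebra.
\<close>

definition hom_ext :: "('k::zero \<Rightarrow> 'b::semiring_1) \<Rightarrow> ('g \<Rightarrow> 'b) \<Rightarrow> ('g, 'k) free_alg \<Rightarrow> 'b" where
  "hom_ext \<eta> h a = (\<Sum>u\<in>Poly_Mapping.keys a.
     \<eta> (Poly_Mapping.lookup a u) * prod_list (map h (letters u)))"

definition antihom_ext :: "('k::zero \<Rightarrow> 'b::semiring_1) \<Rightarrow> ('g \<Rightarrow> 'b) \<Rightarrow> ('g, 'k) free_alg \<Rightarrow> 'b" where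
  "antihom_ext \<eta> h a = (\<Sum>u\<in>Poly_Mapping.keys a.
     \<eta> (Poly_Mapping.lookup a u) * prod_list (map h (rev (letters u))))"

definition ring_of_class :: "'a::ring_1 ring" where
  "ring_of_class = \<lparr>carrier = UNIV, monoid.mult = (*), one = 1, ring.zero = 0, add = (+)\<rparr>"


section \<open>The generators and the defining relations\<close>

datatype node = N1 | N2

datatype generator =
    Gen_e node
  | Gen_f node
  | Gen_w node
  | Gen_w_inv node
  | Gen_w' node
  | Gen_w'_inv node

type_synonym 'k free_G2 = "(generator, 'k) free_alg"

definition e :: "node \<Rightarrow> 'k::field free_G2" where "e i = gen (Gen_e i)"
definition f :: "node \<Rightarrow> 'k::field free_G2" where "f i = gen (Gen_f i)"
definition w :: "node \<Rightarrow> 'k::field free_G2" where "w i = gen (Gen_w i)"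
definition w_inv :: "node \<Rightarrow> 'k::field free_G2" where "w_inv i = gen (Gen_w_inv i)"
definition w' :: "node \<Rightarrow> 'k::field free_G2" where "w' i = gen (Gen_w' i)"
definition w'_inv :: "node \<Rightarrow> 'k::field free_G2" where "w'_inv i = gen (Gen_w'_inv i)"

text \<open>\<open>pairing r s i j\<close> is \<open>\<langle>\<omega>'\<^sub>i, \<omega>\<^sub>j\<rangle>\<close>.\<close>

fun pairing :: "'k::field \<Rightarrow> 'k \<Rightarrow> node \<Rightarrow> node \<Rightarrow> 'k" where
  "pairing r s N1 N1 = r * s powi (-1)"
| "pairing r s N1 N2 = r powi (-3)"
| "pairing r s N2 N1 = s ^ 3"
| "pairing r s N2 N2 = r ^ 3 * s powi (-3)"

text \<open>\<open>node_param r i\<close> is \<open>r\<^sub>i\<close>, and \<open>node_param s i\<close> is \<open>s\<^sub>i\<close>.\<close>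

fun node_param :: "'k::field \<Rightarrow> node \<Rightarrow> 'k" where
  "node_param q N1 = q"
| "node_param q N2 = q ^ 3"

text \<open>A relation \<open>a = b\<close> is represented by the element \<open>a - b\<close> of the free algebra.\<close>

definition torus_rels :: "'k::field free_G2 set" where
  "torus_rels =
     (let T = range w \<union> range w_inv \<union> range w' \<union> range w'_inv
      in {a * b - b * a | a b. a \<in> T \<and> b \<in> T})
     \<union> range (\<lambda>i. w i * w_inv i - 1)
     \<union> range (\<lambda>i. w' i * w'_inv i - 1)"

definition weight_rels :: "'k::field \<Rightarrow> 'k \<Rightarrow> 'k free_G2 set" where
  "weight_rels r s = (\<Union>i. \<Union>j.
     {w j * e i * w_inv j - pairing r s i j \<bullet> e i,
      w j * f i * w_inv j - inverse (pairing r s i j) \<bullet> f i,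
      w' j * e i * w'_inv j - inverse (pairing r s j i) \<bullet> e i,
      w' j * f i * w'_inv j - pairing r s j i \<bullet> f i})"

definition cross_rels :: "'k::field \<Rightarrow> 'k \<Rightarrow> 'k free_G2 set" where
  "cross_rels r s = (\<Union>i. \<Union>j.
     {e i * f j - f j * e i
        - (if i = j then inverse (node_param r i - node_param s i) \<bullet> (w i - w' i) else 0)})"

definition serre_rels :: "'k::field \<Rightarrow> 'k \<Rightarrow> 'k free_G2 set" where
  "serre_rels r s =
     (let e1 = e N1; e2 = e N2; f1 = f N1; f2 = f N2 in
     {e2^2 * e1 - (r powi (-3) + s powi (-3)) \<bullet> (e2 * e1 * e2)
        + ((r * s) powi (-3)) \<bullet> (e1 * e2^2),
      e1^4 * e2
        - ((r + s) * (r^2 + s^2)) \<bullet> (e1^3 * e2 * e1)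
        + (r * s * (r^2 + s^2) * (r^2 + r * s + s^2)) \<bullet> (e1^2 * e2 * e1^2)
        - ((r * s)^3 * (r + s) * (r^2 + s^2)) \<bullet> (e1 * e2 * e1^3)
        + ((r * s)^6) \<bullet> (e2 * e1^4),
      f1 * f2^2 - (r powi (-3) + s powi (-3)) \<bullet> (f2 * f1 * f2)
        + ((r * s) powi (-3)) \<bullet> (f2^2 * f1),
      f2 * f1^4
        - ((r + s) * (r^2 + s^2)) \<bullet> (f1 * f2 * f1^3)
        + (r * s * (r^2 + s^2) * (r^2 + r * s + s^2)) \<bullet> (f1^2 * f2 * f1^2)
        - ((r * s)^3 * (r + s) * (r^2 + s^2)) \<bullet> (f1^3 * f2 * f1)
        + ((r * s)^6) \<bullet> (f1^4 * f2)})"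

definition G2_rels :: "'k::field \<Rightarrow> 'k \<Rightarrow> 'k free_G2 set" where
  "G2_rels r s = torus_rels \<union> weight_rels r s \<union> cross_rels r s \<union> serre_rels r s"

definition U_G2 :: "'k::field \<Rightarrow> 'k \<Rightarrow> 'k free_G2 set ring" where
  "U_G2 r s = ring_of_class Quot (genideal ring_of_class (G2_rels r s))"

definition to_U :: "'k::field \<Rightarrow> 'k \<Rightarrow> 'k free_G2 \<Rightarrow> 'k free_G2 set" where
  "to_U r s a = genideal ring_of_class (G2_rels r s) +>\<^bsub>ring_of_class\<^esub> a"


section \<open>Quantum root vectors and the restricted quotient\<close>

text \<open>
  Elements of the two quotient algebras are given by representatives in the free algebra;
  \<open>to_U\<close> and \<open>to_u\<close> take their classes.
\<close>

definition E1 :: "'k::field free_G2" where "E1 = e N1"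
definition E2 :: "'k::field free_G2" where "E2 = e N2"

definition E12 :: "'k::field \<Rightarrow> 'k \<Rightarrow> 'k free_G2" where
  "E12 r s = e N1 * e N2 - (s^3) \<bullet> (e N2 * e N1)"

definition E112 :: "'k::field \<Rightarrow> 'k \<Rightarrow> 'k free_G2" where
  "E112 r s = e N1 * E12 r s - (r * s^2) \<bullet> (E12 r s * e N1)"

definition E1112 :: "'k::field \<Rightarrow> 'k \<Rightarrow> 'k free_G2" where
  "E1112 r s = e N1 * E112 r s - (r^2 * s) \<bullet> (E112 r s * e N1)"

definition E11212 :: "'k::field \<Rightarrow> 'k \<Rightarrow> 'k free_G2" where
  "E11212 r s = E112 r s * E12 r s - (r^2 * s) \<bullet> (E12 r s * E112 r s)"

definition F1 :: "'k::field free_G2" where "F1 = f N1"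
definition F2 :: "'k::field free_G2" where "F2 = f N2"

definition F12 :: "'k::field \<Rightarrow> 'k \<Rightarrow> 'k free_G2" where
  "F12 r s = f N2 * f N1 - (r^3) \<bullet> (f N1 * f N2)"

definition F112 :: "'k::field \<Rightarrow> 'k \<Rightarrow> 'k free_G2" where
  "F112 r s = F12 r s * f N1 - (r^2 * s) \<bullet> (f N1 * F12 r s)"

definition F1112 :: "'k::field \<Rightarrow> 'k \<Rightarrow> 'k free_G2" where
  "F1112 r s = F112 r s * f N1 - (r * s^2) \<bullet> (f N1 * F112 r s)"

definition F11212 :: "'k::field \<Rightarrow> 'k \<Rightarrow> 'k free_G2" where
  "F11212 r s = F12 r s * F112 r s - (r * s^2) \<bullet> (F112 r s * F12 r s)"

definition root_vectors :: "'k::field \<Rightarrow> 'k \<Rightarrow> 'k free_G2 set" where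
  "root_vectors r s =
     {E1, E1112 r s, E112 r s, E11212 r s, E12 r s, E2,
      F1, F1112 r s, F112 r s, F11212 r s, F12 r s, F2}"

definition restricted_ideal :: "'k::field \<Rightarrow> 'k \<Rightarrow> nat \<Rightarrow> 'k free_G2 set set" where
  "restricted_ideal r s ell = genideal (U_G2 r s)
     (to_U r s ` ((\<lambda>a. a ^ ell) ` root_vectors r s
        \<union> range (\<lambda>k. w k ^ ell - 1) \<union> range (\<lambda>k. w' k ^ ell - 1)))"

definition u_G2 :: "'k::field \<Rightarrow> 'k \<Rightarrow> nat \<Rightarrow> 'k free_G2 set set ring" where
  "u_G2 r s ell = U_G2 r s Quot restricted_ideal r s ell"

definition to_u :: "'k::field \<Rightarrow> 'k \<Rightarrow> nat \<Rightarrow> 'k free_G2 \<Rightarrow> 'k free_G2 set set" where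
  "to_u r s ell a = restricted_ideal r s ell +>\<^bsub>U_G2 r s\<^esub> to_U r s a"


section \<open>The Hopf structure\<close>

definition comult :: "'k::field free_G2 \<Rightarrow> (generator, 'k) free_alg2" where
  "comult = hom_ext scalar (\<lambda>g. case g of
       Gen_e i \<Rightarrow> tens (e i) 1 + tens (w i) (e i)
     | Gen_f i \<Rightarrow> tens 1 (f i) + tens (f i) (w' i)
     | _ \<Rightarrow> tens (gen g) (gen g))"

definition counit :: "'k::field free_G2 \<Rightarrow> 'k" where
  "counit = hom_ext id (\<lambda>g. case g of Gen_e i \<Rightarrow> 0 | Gen_f i \<Rightarrow> 0 | _ \<Rightarrow> 1)"

definition antipode :: "'k::field free_G2 \<Rightarrow> 'k free_G2" where
  "antipode = antihom_ext scalar (\<lambda>g. case g of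
       Gen_e i \<Rightarrow> - (w_inv i * e i)
     | Gen_f i \<Rightarrow> - (f i * w'_inv i)
     | Gen_w i \<Rightarrow> w_inv i
     | Gen_w_inv i \<Rightarrow> w i
     | Gen_w' i \<Rightarrow> w'_inv i
     | Gen_w'_inv i \<Rightarrow> w' i)"

text \<open>
  In the remaining definitions \<open>A\<close> is a quotient algebra of the free algebra with canonical map
  \<open>\<pi>\<close> and kernel \<open>J\<close>. Its tensor square is \<open>A \<otimes> A = (T \<otimes> T) / (J \<otimes> T + T \<otimes> J)\<close> for the free algebra \<open>T\<close>.
\<close>

definition tensor_ideal ::
  "('a, 'z) ring_scheme \<Rightarrow> (('g, 'k::field) free_alg \<Rightarrow> 'a) \<Rightarrow> ('g, 'k) free_alg2 set" where
  "tensor_ideal A \<pi> = genideal ring_of_class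
     ({tens a 1 | a. \<pi> a = \<zero>\<^bsub>A\<^esub>} \<union> {tens 1 a | a. \<pi> a = \<zero>\<^bsub>A\<^esub>})"

definition tensor_square ::
  "('a, 'z) ring_scheme \<Rightarrow> (('g, 'k::field) free_alg \<Rightarrow> 'a) \<Rightarrow> ('g, 'k) free_alg2 set ring" where
  "tensor_square A \<pi> = ring_of_class Quot tensor_ideal A \<pi>"

definition to_tensor_square ::
  "('a, 'z) ring_scheme \<Rightarrow> (('g, 'k::field) free_alg \<Rightarrow> 'a) \<Rightarrow> ('g, 'k) free_alg2 \<Rightarrow> ('g, 'k) free_alg2 set" where
  "to_tensor_square A \<pi> z = tensor_ideal A \<pi> +>\<^bsub>ring_of_class\<^esub> z"

text \<open>\<open>B \<otimes> B\<close> inside \<open>A \<otimes> A\<close>, for a subspace \<open>B\<close> of \<open>A\<close>.\<close>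

definition sub_tensor ::
  "('a, 'z) ring_scheme \<Rightarrow> (('g, 'k::field) free_alg \<Rightarrow> 'a) \<Rightarrow> 'a set \<Rightarrow> ('g, 'k) free_alg2 set set" where
  "sub_tensor A \<pi> B = generate (add_monoid (tensor_square A \<pi>))
     {to_tensor_square A \<pi> (tens a b) | a b. \<pi> a \<in> B \<and> \<pi> b \<in> B}"

text \<open>
  The structure maps induced on \<open>A\<close>. \<open>comult_graph\<close> and \<open>antipode_graph\<close> are the graphs of the
  induced comultiplication \<open>\<pi> a \<mapsto> (\<pi> \<otimes> \<pi>) (\<Delta> a)\<close> and antipode \<open>\<pi> a \<mapsto> \<pi> (S a)\<close>. They are the
  graphs of functions since the kernel of \<open>\<pi>\<close> is a Hopf ideal; relations are used so that this
  fact is not needed for the definitions to make sense. The last two clauses of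
  \<open>hopf_subalgebra\<close> thus say \<open>\<Delta>(B) \<subseteq> B \<otimes> B\<close> and \<open>S(B) \<subseteq> B\<close>.
\<close>

definition comult_graph ::
  "('a, 'z) ring_scheme \<Rightarrow> ('k::field free_G2 \<Rightarrow> 'a) \<Rightarrow> ('a \<times> (generator, 'k) free_alg2 set) set" where
  "comult_graph A \<pi> = range (\<lambda>a. (\<pi> a, to_tensor_square A \<pi> (comult a)))"

definition antipode_graph :: "('k::field free_G2 \<Rightarrow> 'a) \<Rightarrow> ('a \<times> 'a) set" where
  "antipode_graph \<pi> = range (\<lambda>a. (\<pi> a, \<pi> (antipode a)))"

definition induced_counit :: "('k::field free_G2 \<Rightarrow> 'a) \<Rightarrow> 'a \<Rightarrow> 'k" where
  "induced_counit \<pi> X = the_elem (counit ` {a. \<pi> a = X})"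

definition hopf_subalgebra ::
  "('a, 'z) ring_scheme \<Rightarrow> ('k::field free_G2 \<Rightarrow> 'a) \<Rightarrow> 'a set \<Rightarrow> bool" where
  "hopf_subalgebra A \<pi> B \<longleftrightarrow>
     subring B A \<and> range (\<lambda>c. \<pi> (scalar c)) \<subseteq> B \<and>
     (\<forall>X\<in>B. \<exists>Z\<in>sub_tensor A \<pi> B. (X, Z) \<in> comult_graph A \<pi>) \<and>
     (\<forall>X\<in>B. \<exists>Y\<in>B. (X, Y) \<in> antipode_graph \<pi>)"

definition hopf_subalgebra_generated ::
  "('a, 'z) ring_scheme \<Rightarrow> ('k::field free_G2 \<Rightarrow> 'a) \<Rightarrow> 'a set \<Rightarrow> 'a set" where
  "hopf_subalgebra_generated A \<pi> S = \<Inter>{B. hopf_subalgebra A \<pi> B \<and> S \<subseteq> B}"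

text \<open>For \<open>\<eta>\<close> the inclusion of the scalars into \<open>H\<close> and \<open>\<epsilon>\<close> the counit of \<open>H\<close>.\<close>

definition left_integral ::
  "('a, 'z) ring_scheme \<Rightarrow> ('k \<Rightarrow> 'a) \<Rightarrow> ('a \<Rightarrow> 'k) \<Rightarrow> 'a \<Rightarrow> bool" where
  "left_integral H \<eta> \<epsilon> y \<longleftrightarrow>
     y \<in> carrier H \<and> (\<forall>a\<in>carrier H. a \<otimes>\<^bsub>H\<^esub> y = \<eta> (\<epsilon> a) \<otimes>\<^bsub>H\<^esub> y)"

definition right_integral ::
  "('a, 'z) ring_scheme \<Rightarrow> ('k \<Rightarrow> 'a) \<Rightarrow> ('a \<Rightarrow> 'k) \<Rightarrow> 'a \<Rightarrow> bool" where
  "right_integral H \<eta> \<epsilon> y \<longleftrightarrow>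
     y \<in> carrier H \<and> (\<forall>a\<in>carrier H. y \<otimes>\<^bsub>H\<^esub> a = \<eta> (\<epsilon> a) \<otimes>\<^bsub>H\<^esub> y)"


section \<open>The Borel-type Hopf subalgebra and the candidate integrals\<close>

definition primitive_root_of_unity :: "nat \<Rightarrow> 'k::field \<Rightarrow> bool" where
  "primitive_root_of_unity n q \<longleftrightarrow> n > 0 \<and> q ^ n = 1 \<and> (\<forall>k. 0 < k \<and> k < n \<longrightarrow> q ^ k \<noteq> 1)"

definition borel :: "'k::field \<Rightarrow> 'k \<Rightarrow> nat \<Rightarrow> 'k free_G2 set set ring" where
  "borel r s ell = (u_G2 r s ell)\<lparr>carrier :=
     hopf_subalgebra_generated (u_G2 r s ell) (to_u r s ell)
       (to_u r s ell ` (range e \<union> range w \<union> range w_inv))\<rparr>"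

definition elt_t :: "nat \<Rightarrow> 'k::field free_G2" where
  "elt_t ell = (\<Sum>k<ell. w N1 ^ k) * (\<Sum>k<ell. w N2 ^ k)"

definition elt_x :: "'k::field \<Rightarrow> 'k \<Rightarrow> nat \<Rightarrow> 'k free_G2" where
  "elt_x r s ell = E2 ^ (ell - 1) * E12 r s ^ (ell - 1) * E11212 r s ^ (ell - 1)
     * E112 r s ^ (ell - 1) * E1112 r s ^ (ell - 1) * E1 ^ (ell - 1)"

end

theory Submission
  imports Defs
begin

text \<open>
  Since \<open>t\<close> absorbs the group-likes and each \<open>e\<^sub>i\<close> commutes with \<open>\<omega>\<^sub>j\<close> up to a non-zero scalar, it
  suffices that \<open>e\<^sub>i x = 0 = x e\<^sub>i\<close>. The root vectors \<open>E\<^sub>2, E\<^sub>1\<^sub>2, E\<^sub>1\<^sub>1\<^sub>2\<^sub>1\<^sub>2, E\<^sub>1\<^sub>1\<^sub>2, E\<^sub>1\<^sub>1\<^sub>1\<^sub>2, E\<^sub>1\<close> are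
  in convex order: two of them commute up to a scalar and products of intermediate ones. Hence, by
  induction on \<open>k\<close>, the product of the first \<open>k\<close> of the \<open>(\<ell>-1)\<close>st powers is annihilated from the
  right by the first \<open>k\<close> root vectors, the \<open>k\<close>th one because its \<open>\<ell>\<close>th power vanishes; symmetrically
  on the left. No PBW basis is needed. All computations are carried out in the free algebra, modulo the
  kernel \<open>J\<close> of the projection to \<open>u\<^sub>r\<^sub>,\<^sub>s(G\<^sub>2)\<close>.
\<close>

section \<open>Annihilators modulo a two-sided ideal\<close>

locale two_sided_ideal =
  fixes J :: "'a::ring_1 set"
  assumes zero_mem [simp]: "0 \<in> J"
    and add_mem: "\<lbrakk>x \<in> J; y \<in> J\<rbrakk> \<Longrightarrow> x + y \<in> J"
    and lmult_mem: "x \<in> J \<Longrightarrow> y * x \<in> J"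
    and rmult_mem: "x \<in> J \<Longrightarrow> x * y \<in> J"
begin

lemma uminus_mem: "x \<in> J \<Longrightarrow> - x \<in> J"
  using lmult_mem[of x "- 1"] by simp

lemma diff_mem: "\<lbrakk>x \<in> J; y \<in> J\<rbrakk> \<Longrightarrow> x - y \<in> J"
  using add_mem[of x "- y"] uminus_mem[of y] by simp

lemma sum_mem: "(\<And>i. i \<in> I \<Longrightarrow> h i \<in> J) \<Longrightarrow> (\<Sum>i\<in>I. h i) \<in> J"
  by (induction I rule: infinite_finite_induct) (simp_all add: add_mem)

text \<open>\<open>push\<close> is quantified over all multipliers because the induction applies it
  to \<open>z * g ^ k\<close>, which changes at every step.\<close>

lemma right_annihilated_power:
  assumes push: "\<And>z. \<forall>x\<in>S. z * x \<in> J \<Longrightarrow> \<forall>x\<in>S. z * g * x \<in> J"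
    and z: "\<forall>x\<in>S. z * x \<in> J"
  shows "\<forall>x\<in>S. z * g ^ k * x \<in> J"
proof (induction k)
  case (Suc k)
  from push[OF Suc.IH] show ?case by (simp only: power_Suc2 mult.assoc)
qed (use z in simp)

lemma left_annihilated_power:
  assumes push: "\<And>z. \<forall>x\<in>S. x * z \<in> J \<Longrightarrow> \<forall>x\<in>S. x * (g * z) \<in> J"
    and z: "\<forall>x\<in>S. x * z \<in> J"
  shows "\<forall>x\<in>S. x * (g ^ k * z) \<in> J"
proof (induction k)
  case (Suc k)
  from push[OF Suc.IH] show ?case by (simp only: power_Suc mult.assoc)
qed (use z in simp)

text \<open>Elements of \<open>S\<close> are passed one factor \<open>g\<close> at a time; the new
  element \<open>g\<close> completes \<open>g ^ k\<close> to \<open>g ^ Suc k\<close>, which lies in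
  \<open>J\<close>.\<close>

lemma right_annihilated_insert:
  assumes "\<And>z. \<forall>x\<in>S. z * x \<in> J \<Longrightarrow> \<forall>x\<in>S. z * g * x \<in> J"
    and "\<forall>x\<in>S. z * x \<in> J" and g: "g ^ Suc k \<in> J"
  shows "\<forall>x\<in>insert g S. z * g ^ k * x \<in> J"
  using right_annihilated_power[of S g z k, OF assms(1,2)] lmult_mem[OF g, of z]
  by (simp add: power_Suc2 mult.assoc del: power_Suc)

lemma left_annihilated_insert:
  assumes "\<And>z. \<forall>x\<in>S. x * z \<in> J \<Longrightarrow> \<forall>x\<in>S. x * (g * z) \<in> J"
    and "\<forall>x\<in>S. x * z \<in> J" and g: "g ^ Suc k \<in> J"
  shows "\<forall>x\<in>insert g S. x * (g ^ k * z) \<in> J"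
  using left_annihilated_power[of S g z k, OF assms(1,2)] rmult_mem[OF g, of z]
  by (simp add: mult.assoc)

lemmas mem_intros = add_mem diff_mem lmult_mem rmult_mem

end

section \<open>Commutation of the root vectors\<close>

text \<open>
  The parameters stand for \<open>p = r\<^sup>3\<close>, \<open>q = s\<^sup>3\<close>, \<open>m = rs\<^sup>2\<close>, \<open>n = r\<^sup>2s\<close>: these are the roots of the
  characteristic polynomial of the quartic Serre relation, whose coefficients are thus their elementary
  symmetric functions. The three relations between them, read from left to right, form a Groebner
  basis of the ideal of the twisted cubic, so the simplifier decides equality of coefficients.
\<close>

locale serre_g2 = two_sided_ideal J for J :: "'a::ring_1 set" +
  fixes p q m n a b :: 'a
  assumes central: "c \<in> {p, q, m, n} \<Longrightarrow> x * c = c * x"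
    and mn: "m * n = p * q" and mm: "m * m = q * n" and nn: "n * n = p * m"
    and cancel: "\<lbrakk>c \<in> {p, q, p + q, m + n, m * m + n * n}; c * x \<in> J\<rbrakk> \<Longrightarrow> x \<in> J"
    and serre_abb: "a * b^2 - (p + q) * (b * a * b) + p * q * (b^2 * a) \<in> J"
    and serre_aaaab: "a^4 * b - (p + q + m + n) * (a^3 * b * a)
          + (p * q + p * m + p * n + q * m + q * n + m * n) * (a^2 * b * a^2)
          - (p * q * m + p * q * n + p * m * n + q * m * n) * (a * b * a^3)
          + p * q * m * n * (b * a^4) \<in> J"
begin

definition "ab = a * b - q * (b * a)"
definition "aab = a * ab - m * (ab * a)"
definition "aaab = a * aab - n * (aab * a)"
definition "aabab = aab * ab - n * (ab * aab)"

lemma left_central: "c \<in> {p, q, m, n} \<Longrightarrow> x * (c * y) = c * (x * y)"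
  by (metis central mult.assoc)

lemmas centrals = central[of p, simplified] central[of q, simplified] central[of m, simplified]
  central[of n, simplified]
lemmas left_centrals = left_central[of p, simplified] left_central[of q, simplified]
  left_central[of m, simplified] left_central[of n, simplified]

text \<open>Only instances at the root vectors: rewriting moves coefficients to the left of these
  but does not permute coefficients among themselves, which is left to
  \<open>coefficients\<close>.\<close>

lemmas central_simps =
  centrals[of a] centrals[of b] centrals[of ab] centrals[of aab] centrals[of aaab] centrals[of aabab]
  left_centrals[of a] left_centrals[of b] left_centrals[of ab] left_centrals[of aab]
  left_centrals[of aaab] left_centrals[of aabab]

text \<open>Together with \<open>mn\<close>, \<open>mm\<close> and \<open>nn\<close> this brings
  each coefficient monomial into the form of a monomial in \<open>p\<close> and \<open>q\<close>
  times \<open>1\<close>, \<open>m\<close> or \<open>n\<close>.\<close>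

lemma coefficients:
  "q * p = p * q" "m * p = p * m" "n * p = p * n" "m * q = q * m" "n * q = q * n"
  "n * m = p * q"
  by (simp_all only: centrals(1)[of q] centrals(1)[of m] centrals(1)[of n] centrals(2)[of m]
      centrals(2)[of n] centrals(3)[of n] mn)

lemmas coefficient_simps = coefficients mn mm nn

text \<open>Products are bracketed to the right, so a rule for \<open>u * v\<close> also needs a
  version that carries a trailing factor \<open>x\<close>.\<close>

lemmas left_coefficient_simps =
  coefficient_simps[THEN arg_cong[where f = "\<lambda>t. t * x" for x], unfolded mult.assoc]

lemma a_b: "a * b = q * (b * a) + ab"
  by (simp add: ab_def)

lemma a_ab: "a * ab = m * (ab * a) + aab"
  by (simp add: aab_def)

lemma a_aab: "a * aab = n * (aab * a) + aaab"
  by (simp add: aaab_def)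

lemma aab_ab: "aab * ab = n * (ab * aab) + aabab"
  by (simp add: aabab_def)

lemmas push_simps = a_b a_ab a_aab aab_ab

lemmas left_push_simps = push_simps[THEN arg_cong[where f = "\<lambda>t. t * x" for x], unfolded mult.assoc]

lemmas normalize = algebra_simps power2_eq_square power3_eq_cube power4_eq_xxxx central_simps
  coefficient_simps left_coefficient_simps

text \<open>Skew Leibniz rule for \<open>a\<close>: the two terms \<open>n * (aab * aab)\<close>
  cancel because \<open>n\<close> is the coefficient in \<open>aabab\<close>, and
  \<open>m * n = p * q\<close>.\<close>

lemma a_aabab: "a * aabab = p * q * (aabab * a) + aaab * ab - p * q * (ab * aaab)"
  \<comment> \<open>The fourth straightening rule \<open>aab_ab\<close> is left out, since it would
    undo the unfolding of \<open>aabab_def\<close>.\<close>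
  by (simp add: aabab_def normalize push_simps(1-3) left_push_simps(1-3))

lemmas nf = normalize push_simps left_push_simps
  a_aabab a_aabab[THEN arg_cong[where f = "\<lambda>t. t * x" for x], unfolded mult.assoc]

text \<open>
  Apart from the Serre relations \<open>rel_ab_b\<close> and \<open>rel_a_aaab\<close>, each relation arises from an earlier
  one by the skew commutator with \<open>a\<close>; only \<open>rel_aabab_b\<close> comes directly from the definition of \<open>aabab\<close>. The membership
  proofs are certificates: identities in the free algebra that express a multiple of the relation by
  earlier ones.
\<close>

definition "rel_ab_b = ab * b - p * (b * ab)"
definition "rel_aab_b = aab * b - p * q * (b * aab) - (p - m) * (ab * ab)"
definition "rel_aaab_b = aaab * b - p * q * q * (b * aaab)
  - (p * q + p * m - m * m) * (ab * aab) - (p - m - n) * (aab * ab)"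
text \<open>Scaled by \<open>m + n\<close> because the true coefficient of \<open>aab * aab\<close>
  is the fraction \<open>(p - q) * n / (m + n)\<close>, that is,
  \<open>r * (r^3 - s^3) / (r + s)\<close>.\<close>

definition "rel_aaab_ab = (m + n) * (aaab * ab) - p * q * (m + n) * (ab * aaab) - (p - q) * n * (aab * aab)"
definition "rel_aaab_aab = aaab * aab - p * (aab * aaab)"
definition "rel_a_aaab = a * aaab - p * (aaab * a)"
definition "rel_aabab_b = aabab * b - p * p * q * (b * aabab) - (p - n) * (p - m) * (ab * ab * ab)"
definition "rel_aabab_ab = aabab * ab - p * (ab * aabab)"
definition "rel_aab_aabab = aab * aabab - p * (aabab * aab)"

text \<open>The cubic Serre relation has the roots \<open>p\<close> and \<open>q\<close>. The
  definition of \<open>ab\<close> uses up \<open>q\<close>, so the skew commutator with the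
  remaining root \<open>p\<close> vanishes.\<close>

lemma rel_ab_b_mem: "rel_ab_b \<in> J"
proof -
  have "rel_ab_b = a * b^2 - (p + q) * (b * a * b) + p * q * (b^2 * a)"
    by (simp add: rel_ab_b_def ab_def normalize)
  then show ?thesis using serre_abb by simp
qed

text \<open>Three of the four roots, \<open>q\<close>, \<open>m\<close> and \<open>n\<close>, are
  used up by \<open>ab\<close>, \<open>aab\<close> and \<open>aaab\<close>; the quartic Serre
  relation is the skew commutator with the last root \<open>p\<close>.\<close>

lemma rel_a_aaab_mem: "rel_a_aaab \<in> J"
proof -
  have "rel_a_aaab = a^4 * b - (p + q + m + n) * (a^3 * b * a)
          + (p * q + p * m + p * n + q * m + q * n + m * n) * (a^2 * b * a^2)
          - (p * q * m + p * q * n + p * m * n + q * m * n) * (a * b * a^3)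
          + p * q * m * n * (b * a^4)"
    by (simp add: rel_a_aaab_def nf)
  then show ?thesis using serre_aaaab by simp
qed

lemma rel_aab_b_mem: "rel_aab_b \<in> J"
proof -
  \<comment> \<open>Up to later terms, \<open>a\<close> passes \<open>b\<close>, \<open>ab\<close>,
    \<open>aab\<close>, \<open>aaab\<close> with the factors \<open>q\<close>, \<open>m\<close>,
    \<open>n\<close>, \<open>p\<close>, and \<open>aabab\<close> with \<open>p * q\<close>. The
    factor of a skew commutator with \<open>a\<close> is the product of these, here
    \<open>m * q\<close>.\<close>
  have "rel_aab_b = a * rel_ab_b - m * q * (rel_ab_b * a)"
    by (simp add: rel_ab_b_def rel_aab_b_def nf)
  then show ?thesis by (simp add: mem_intros rel_ab_b_mem)
qed

lemma rel_aaab_b_mem: "rel_aaab_b \<in> J"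
proof -
  have "rel_aaab_b = a * rel_aab_b - n * q * (rel_aab_b * a)"
    by (simp add: rel_aaab_b_def rel_aab_b_def nf)
  then show ?thesis by (simp add: mem_intros rel_aab_b_mem)
qed

lemma rel_aaab_ab_mem: "rel_aaab_ab \<in> J"
proof -
  \<comment> \<open>The products \<open>a * aaab\<close> that arise have no rule in
    \<open>nf\<close>; the last two terms remove them by the quartic Serre relation.\<close>
  have "rel_aaab_ab = a * rel_aaab_b - p * q * (rel_aaab_b * a) - rel_a_aaab * b
      + p * q * q * q * (b * rel_a_aaab)"
    by (simp add: rel_aaab_b_def rel_aaab_ab_def rel_a_aaab_def nf)
  then show ?thesis by (simp add: mem_intros rel_aaab_b_mem rel_a_aaab_mem)
qed

lemma rel_aaab_aab_mem: "rel_aaab_aab \<in> J"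
proof -
  \<comment> \<open>The coefficient of \<open>aaab * aab\<close> is
    \<open>p * (m + n) - (p - q) * n = p * m + q * n\<close>, which equals
    \<open>m * m + n * n\<close>.\<close>
  have "(m * m + n * n) * rel_aaab_aab =
      a * rel_aaab_ab - p * m * (rel_aaab_ab * a) - (m + n) * (rel_a_aaab * ab)
      + p * q * (m + n) * m * (ab * rel_a_aaab)"
    by (simp add: rel_aaab_ab_def rel_aaab_aab_def rel_a_aaab_def nf)
  then have "(m * m + n * n) * rel_aaab_aab \<in> J"
    by (simp add: mem_intros rel_aaab_ab_mem rel_a_aaab_mem)
  then show ?thesis by (rule cancel[rotated]) simp
qed

lemma rel_aabab_b_mem: "rel_aabab_b \<in> J"
proof -
  \<comment> \<open>The four terms are the four passages of \<open>b\<close> to the left: past each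
    factor of \<open>aab * ab\<close> and of \<open>ab * aab\<close>.\<close>
  have "rel_aabab_b = aab * rel_ab_b - n * (ab * rel_aab_b) + p * (rel_aab_b * ab)
      - p * q * n * (rel_ab_b * aab)"
    by (simp add: rel_ab_b_def rel_aab_b_def rel_aabab_b_def nf)
  then show ?thesis by (simp add: mem_intros rel_ab_b_mem rel_aab_b_mem)
qed

lemma rel_aabab_ab_mem: "rel_aabab_ab \<in> J"
proof -
  \<comment> \<open>Moving \<open>a\<close> past \<open>aabab\<close> leaves
    \<open>aaab * ab - p * q * (ab * aaab)\<close> next to \<open>b\<close>. Here
    \<open>rel_aaab_ab\<close> turns it into a multiple of \<open>aab * aab\<close>, and
    \<open>rel_aab_b\<close>, used twice, moves \<open>b\<close> to the left of that.\<close>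
  have "p * (q * ((p + q) * rel_aabab_ab)) =
      (m + n) * (a * rel_aabab_b - p * q * q * (rel_aabab_b * a)) - rel_aaab_ab * b
      + p * p * q * q * (b * rel_aaab_ab)
      - (p - q) * n * (aab * rel_aab_b + p * q * (rel_aab_b * aab))"
    by (simp add: rel_aab_b_def rel_aaab_ab_def rel_aabab_b_def rel_aabab_ab_def nf)
  then have "p * (q * ((p + q) * rel_aabab_ab)) \<in> J"
    by (simp add: mem_intros rel_aab_b_mem rel_aaab_ab_mem rel_aabab_b_mem)
  then have "q * ((p + q) * rel_aabab_ab) \<in> J" by (rule cancel[rotated]) simp
  then have "(p + q) * rel_aabab_ab \<in> J" by (rule cancel[rotated]) simp
  then show ?thesis by (rule cancel[rotated]) simp
qed

lemma rel_aab_aabab_mem: "rel_aab_aabab \<in> J"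
proof -
  \<comment> \<open>Again \<open>rel_aaab_ab\<close> replaces the commutator of \<open>a\<close> and
    \<open>aabab\<close> by \<open>aab * aab\<close>; moving \<open>ab\<close> to the left through
    this recreates \<open>aabab\<close>, and the coefficient is once more
    \<open>p * (m + n) - (p - q) * n\<close>.\<close>
  have "(m * m + n * n) * rel_aab_aabab =
      rel_aaab_ab * ab - p * m * (ab * rel_aaab_ab)
      - (m + n) * (a * rel_aabab_ab - p * q * m * (rel_aabab_ab * a))"
    by (simp add: rel_aaab_ab_def rel_aabab_ab_def rel_aab_aabab_def nf)
  then have "(m * m + n * n) * rel_aab_aabab \<in> J"
    by (simp add: mem_intros rel_aaab_ab_mem rel_aabab_ab_mem)
  then show ?thesis by (rule cancel[rotated]) simp
qed

lemmas cofactor_simps = algebra_simps coefficient_simps left_coefficient_simps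

text \<open>A left multiplier that annihilates, modulo \<open>J\<close>, the root vectors preceding \<open>g\<close> in the convex
  order keeps doing so after multiplication by \<open>g\<close>, since moving \<open>g\<close> past them only creates
  root vectors in between.\<close>

lemma right_push:
  shows "z * b \<in> J \<Longrightarrow> z * ab * b \<in> J"
    and "\<lbrakk>z * b \<in> J; z * ab \<in> J\<rbrakk> \<Longrightarrow> z * aabab * b \<in> J"
    and "z * ab \<in> J \<Longrightarrow> z * aabab * ab \<in> J"
    and "\<lbrakk>z * b \<in> J; z * ab \<in> J\<rbrakk> \<Longrightarrow> z * aab * b \<in> J"
    and "\<lbrakk>z * ab \<in> J; z * aabab \<in> J\<rbrakk> \<Longrightarrow> z * aab * ab \<in> J"
    and "z * aabab \<in> J \<Longrightarrow> z * aab * aabab \<in> J"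
    and "\<lbrakk>z * b \<in> J; z * ab \<in> J; z * aab \<in> J\<rbrakk> \<Longrightarrow> z * aaab * b \<in> J"
    and "\<lbrakk>z * ab \<in> J; z * aab \<in> J\<rbrakk> \<Longrightarrow> z * aaab * ab \<in> J"
    and "z * aab \<in> J \<Longrightarrow> z * aaab * aab \<in> J"
    and "\<lbrakk>z * b \<in> J; z * ab \<in> J\<rbrakk> \<Longrightarrow> z * a * b \<in> J"
    and "\<lbrakk>z * ab \<in> J; z * aab \<in> J\<rbrakk> \<Longrightarrow> z * a * ab \<in> J"
    and "\<lbrakk>z * aab \<in> J; z * aaab \<in> J\<rbrakk> \<Longrightarrow> z * a * aab \<in> J"
    and "z * aaab \<in> J \<Longrightarrow> z * a * aaab \<in> J"
proof -
  note [simp] = mem_intros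
  note z = centrals[of z] left_centrals[of z]
  show "z * b \<in> J \<Longrightarrow> z * ab * b \<in> J"
  proof -
    have "z * ab * b = z * rel_ab_b + p * (z * b * ab)" by (simp add: rel_ab_b_def cofactor_simps z)
    then show "z * b \<in> J \<Longrightarrow> z * ab * b \<in> J" by (simp add: rel_ab_b_mem)
  qed
  show "\<lbrakk>z * b \<in> J; z * ab \<in> J\<rbrakk> \<Longrightarrow> z * aabab * b \<in> J"
  proof -
    have "z * aabab * b = z * rel_aabab_b + p * p * q * (z * b * aabab) + (p - n) * (p - m) * (z * ab * (ab * ab))"
      by (simp add: rel_aabab_b_def cofactor_simps z)
    then show "\<lbrakk>z * b \<in> J; z * ab \<in> J\<rbrakk> \<Longrightarrow> z * aabab * b \<in> J" by (simp add: rel_aabab_b_mem)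
  qed
  show "z * ab \<in> J \<Longrightarrow> z * aabab * ab \<in> J"
  proof -
    have "z * aabab * ab = z * rel_aabab_ab + p * (z * ab * aabab)" by (simp add: rel_aabab_ab_def cofactor_simps z)
    then show "z * ab \<in> J \<Longrightarrow> z * aabab * ab \<in> J" by (simp add: rel_aabab_ab_mem)
  qed
  show "\<lbrakk>z * b \<in> J; z * ab \<in> J\<rbrakk> \<Longrightarrow> z * aab * b \<in> J"
  proof -
    have "z * aab * b = z * rel_aab_b + p * q * (z * b * aab) + (p - m) * (z * ab * ab)"
      by (simp add: rel_aab_b_def cofactor_simps z)
    then show "\<lbrakk>z * b \<in> J; z * ab \<in> J\<rbrakk> \<Longrightarrow> z * aab * b \<in> J" by (simp add: rel_aab_b_mem)
  qed
  show "\<lbrakk>z * ab \<in> J; z * aabab \<in> J\<rbrakk> \<Longrightarrow> z * aab * ab \<in> J"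
  proof -
    have "z * aab * ab = n * (z * ab * aab) + z * aabab" by (simp add: aabab_def cofactor_simps z)
    then show "\<lbrakk>z * ab \<in> J; z * aabab \<in> J\<rbrakk> \<Longrightarrow> z * aab * ab \<in> J" by simp
  qed
  show "z * aabab \<in> J \<Longrightarrow> z * aab * aabab \<in> J"
  proof -
    have "z * aab * aabab = z * rel_aab_aabab + p * (z * aabab * aab)" by (simp add: rel_aab_aabab_def cofactor_simps z)
    then show "z * aabab \<in> J \<Longrightarrow> z * aab * aabab \<in> J" by (simp add: rel_aab_aabab_mem)
  qed
  show "\<lbrakk>z * b \<in> J; z * ab \<in> J; z * aab \<in> J\<rbrakk> \<Longrightarrow> z * aaab * b \<in> J"
  proof -
    have "z * aaab * b = z * rel_aaab_b + p * q * q * (z * b * aaab)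
        + (p * q + p * m - m * m) * (z * ab * aab) + (p - m - n) * (z * aab * ab)"
      by (simp add: rel_aaab_b_def cofactor_simps z)
    then show "\<lbrakk>z * b \<in> J; z * ab \<in> J; z * aab \<in> J\<rbrakk> \<Longrightarrow> z * aaab * b \<in> J" by (simp add: rel_aaab_b_mem)
  qed
  show "\<lbrakk>z * ab \<in> J; z * aab \<in> J\<rbrakk> \<Longrightarrow> z * aaab * ab \<in> J"
  proof -
    assume "z * ab \<in> J" "z * aab \<in> J"
    \<comment> \<open>The straightening rule for \<open>aaab * ab\<close> is known only after
      scaling by \<open>m + n\<close>, which is cancelled afterwards.\<close>
    moreover have "(m + n) * (z * aaab * ab) = z * rel_aaab_ab + p * q * (m + n) * (z * ab * aaab)
        + (p - q) * n * (z * aab * aab)"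
      by (simp add: rel_aaab_ab_def cofactor_simps z)
    ultimately have "(m + n) * (z * aaab * ab) \<in> J" by (simp add: rel_aaab_ab_mem)
    then show "z * aaab * ab \<in> J" by (rule cancel[rotated]) simp
  qed
  show "z * aab \<in> J \<Longrightarrow> z * aaab * aab \<in> J"
  proof -
    have "z * aaab * aab = z * rel_aaab_aab + p * (z * aab * aaab)" by (simp add: rel_aaab_aab_def cofactor_simps z)
    then show "z * aab \<in> J \<Longrightarrow> z * aaab * aab \<in> J" by (simp add: rel_aaab_aab_mem)
  qed
  show "\<lbrakk>z * b \<in> J; z * ab \<in> J\<rbrakk> \<Longrightarrow> z * a * b \<in> J"
  proof -
    have "z * a * b = q * (z * b * a) + z * ab" by (simp add: ab_def cofactor_simps z)
    then show "\<lbrakk>z * b \<in> J; z * ab \<in> J\<rbrakk> \<Longrightarrow> z * a * b \<in> J" by simp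
  qed
  show "\<lbrakk>z * ab \<in> J; z * aab \<in> J\<rbrakk> \<Longrightarrow> z * a * ab \<in> J"
  proof -
    have "z * a * ab = m * (z * ab * a) + z * aab" by (simp add: aab_def cofactor_simps z)
    then show "\<lbrakk>z * ab \<in> J; z * aab \<in> J\<rbrakk> \<Longrightarrow> z * a * ab \<in> J" by simp
  qed
  show "\<lbrakk>z * aab \<in> J; z * aaab \<in> J\<rbrakk> \<Longrightarrow> z * a * aab \<in> J"
  proof -
    have "z * a * aab = n * (z * aab * a) + z * aaab" by (simp add: aaab_def cofactor_simps z)
    then show "\<lbrakk>z * aab \<in> J; z * aaab \<in> J\<rbrakk> \<Longrightarrow> z * a * aab \<in> J" by simp
  qed
  show "z * aaab \<in> J \<Longrightarrow> z * a * aaab \<in> J"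
  proof -
    have "z * a * aaab = z * rel_a_aaab + p * (z * aaab * a)" by (simp add: rel_a_aaab_def cofactor_simps z)
    then show "z * aaab \<in> J \<Longrightarrow> z * a * aaab \<in> J" by (simp add: rel_a_aaab_mem)
  qed
qed

text \<open>Mirror image of \<open>right_push\<close>: the annihilators are now the root vectors
  that follow the new factor in the convex order, and they are moved to the right past it.\<close>

lemma left_push:
  shows "a * z \<in> J \<Longrightarrow> a * (aaab * z) \<in> J"
    and "\<lbrakk>a * z \<in> J; aaab * z \<in> J\<rbrakk> \<Longrightarrow> a * (aab * z) \<in> J"
    and "aaab * z \<in> J \<Longrightarrow> aaab * (aab * z) \<in> J"
    and "\<lbrakk>a * z \<in> J; aab * z \<in> J\<rbrakk> \<Longrightarrow> a * (aabab * z) \<in> J"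
    and "aab * z \<in> J \<Longrightarrow> aab * (aabab * z) \<in> J"
    and "\<lbrakk>a * z \<in> J; aab * z \<in> J\<rbrakk> \<Longrightarrow> a * (ab * z) \<in> J"
    and "\<lbrakk>aab * z \<in> J; aabab * z \<in> J\<rbrakk> \<Longrightarrow> aab * (ab * z) \<in> J"
    and "aabab * z \<in> J \<Longrightarrow> aabab * (ab * z) \<in> J"
    and "\<lbrakk>a * z \<in> J; ab * z \<in> J\<rbrakk> \<Longrightarrow> a * (b * z) \<in> J"
    and "ab * z \<in> J \<Longrightarrow> ab * (b * z) \<in> J"
proof -
  note [simp] = mem_intros
  show "a * z \<in> J \<Longrightarrow> a * (aaab * z) \<in> J"
  proof -
    have "a * (aaab * z) = rel_a_aaab * z + p * (aaab * (a * z))" by (simp add: rel_a_aaab_def cofactor_simps)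
    then show "a * z \<in> J \<Longrightarrow> a * (aaab * z) \<in> J" by (simp add: rel_a_aaab_mem)
  qed
  show "\<lbrakk>a * z \<in> J; aaab * z \<in> J\<rbrakk> \<Longrightarrow> a * (aab * z) \<in> J"
    by (simp add: left_push_simps(3) distrib_right mult.assoc)
  show "aaab * z \<in> J \<Longrightarrow> aaab * (aab * z) \<in> J"
  proof -
    have "aaab * (aab * z) = rel_aaab_aab * z + p * (aab * (aaab * z))" by (simp add: rel_aaab_aab_def cofactor_simps)
    then show "aaab * z \<in> J \<Longrightarrow> aaab * (aab * z) \<in> J" by (simp add: rel_aaab_aab_mem)
  qed
  show "\<lbrakk>a * z \<in> J; aab * z \<in> J\<rbrakk> \<Longrightarrow> a * (aabab * z) \<in> J"
  proof -
    assume "a * z \<in> J" "aab * z \<in> J"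
    \<comment> \<open>By \<open>a_aabab\<close>, \<open>a\<close> passes \<open>aabab\<close> up to
      \<open>aaab * ab - p * q * (ab * aaab)\<close>, which \<open>rel_aaab_ab\<close> makes a
      multiple of \<open>aab * aab\<close> after scaling by \<open>m + n\<close>.\<close>
    moreover have "(m + n) * (a * (aabab * z)) = p * q * (m + n) * (aabab * (a * z)) + rel_aaab_ab * z
        + (p - q) * n * (aab * (aab * z))"
      by (simp add: rel_aaab_ab_def nf)
    ultimately have "(m + n) * (a * (aabab * z)) \<in> J" by (simp add: rel_aaab_ab_mem)
    then show "a * (aabab * z) \<in> J" by (rule cancel[rotated]) simp
  qed
  show "aab * z \<in> J \<Longrightarrow> aab * (aabab * z) \<in> J"
  proof -
    have "aab * (aabab * z) = rel_aab_aabab * z + p * (aabab * (aab * z))" by (simp add: rel_aab_aabab_def cofactor_simps)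
    then show "aab * z \<in> J \<Longrightarrow> aab * (aabab * z) \<in> J" by (simp add: rel_aab_aabab_mem)
  qed
  show "\<lbrakk>a * z \<in> J; aab * z \<in> J\<rbrakk> \<Longrightarrow> a * (ab * z) \<in> J"
    by (simp add: left_push_simps(2) distrib_right mult.assoc)
  show "\<lbrakk>aab * z \<in> J; aabab * z \<in> J\<rbrakk> \<Longrightarrow> aab * (ab * z) \<in> J"
    by (simp add: left_push_simps(4) distrib_right mult.assoc)
  show "aabab * z \<in> J \<Longrightarrow> aabab * (ab * z) \<in> J"
  proof -
    have "aabab * (ab * z) = rel_aabab_ab * z + p * (ab * (aabab * z))" by (simp add: rel_aabab_ab_def cofactor_simps)
    then show "aabab * z \<in> J \<Longrightarrow> aabab * (ab * z) \<in> J" by (simp add: rel_aabab_ab_mem)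
  qed
  show "\<lbrakk>a * z \<in> J; ab * z \<in> J\<rbrakk> \<Longrightarrow> a * (b * z) \<in> J"
    by (simp add: left_push_simps(1) distrib_right mult.assoc)
  show "ab * z \<in> J \<Longrightarrow> ab * (b * z) \<in> J"
  proof -
    have "ab * (b * z) = rel_ab_b * z + p * (b * (ab * z))" by (simp add: rel_ab_b_def cofactor_simps)
    then show "ab * z \<in> J \<Longrightarrow> ab * (b * z) \<in> J" by (simp add: rel_ab_b_mem)
  qed
qed

section \<open>The product of the powers of the root vectors\<close>

definition "root_product k = b ^ k * ab ^ k * aabab ^ k * aab ^ k * aaab ^ k * a ^ k"

context
  fixes k :: nat
  assumes nilpotent: "c \<in> {a, b, ab, aab, aaab, aabab} \<Longrightarrow> c ^ Suc k \<in> J"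
begin

lemma root_product_right_annihilates: "root_product k * a \<in> J" "root_product k * b \<in> J"
proof -
  have b: "\<forall>x\<in>{b}. b ^ k * x \<in> J"
    using nilpotent[of b] by (simp add: power_Suc2 del: power_Suc)
  have "\<forall>x\<in>insert ab {b}. b ^ k * ab ^ k * x \<in> J"
    by (intro right_annihilated_insert b nilpotent) (simp_all add: right_push)
  then have "\<forall>x\<in>insert aabab {b, ab}. b ^ k * ab ^ k * aabab ^ k * x \<in> J"
    by (intro right_annihilated_insert nilpotent) (simp_all add: right_push)
  then have "\<forall>x\<in>insert aab {b, ab, aabab}. b ^ k * ab ^ k * aabab ^ k * aab ^ k * x \<in> J"
    by (intro right_annihilated_insert nilpotent) (simp_all add: right_push)
  \<comment> \<open>From here on the annihilators carried along are \<open>b\<close>,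
    \<open>ab\<close>, \<open>aab\<close>: this set is closed under moving \<open>aaab\<close> past
    its members, which creates only \<open>ab\<close> and \<open>aab\<close>.\<close>
  then have "\<forall>x\<in>insert aaab {b, ab, aab}. b ^ k * ab ^ k * aabab ^ k * aab ^ k * aaab ^ k * x \<in> J"
    by (intro right_annihilated_insert nilpotent) (simp_all add: right_push)
  then have "\<forall>x\<in>insert a {b, ab, aab, aaab}. root_product k * x \<in> J"
    unfolding root_product_def
    by (intro right_annihilated_insert nilpotent) (simp_all add: right_push)
  then show "root_product k * a \<in> J" "root_product k * b \<in> J" by auto
qed

text \<open>The same product is now built from its right end, in the order \<open>a\<close>,
  \<open>aaab\<close>, \<open>aab\<close>, \<open>aabab\<close>, \<open>ab\<close>,
  \<open>b\<close>.\<close>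

lemma root_product_left_annihilates: "a * root_product k \<in> J" "b * root_product k \<in> J"
proof -
  have a: "\<forall>x\<in>{a}. x * a ^ k \<in> J"
    using nilpotent[of a] by simp
  have "\<forall>x\<in>insert aaab {a}. x * (aaab ^ k * a ^ k) \<in> J"
    by (intro left_annihilated_insert a nilpotent) (simp_all add: left_push)
  then have "\<forall>x\<in>insert aab {a, aaab}. x * (aab ^ k * (aaab ^ k * a ^ k)) \<in> J"
    by (intro left_annihilated_insert nilpotent) (simp_all add: left_push)
  \<comment> \<open>Moving \<open>aabab\<close> past \<open>a\<close> and \<open>aab\<close> creates
    only \<open>aab\<close>, so these two suffice as annihilators.\<close>
  then have "\<forall>x\<in>insert aabab {a, aab}. x * (aabab ^ k * (aab ^ k * (aaab ^ k * a ^ k))) \<in> J"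
    by (intro left_annihilated_insert nilpotent) (simp_all add: left_push)
  then have "\<forall>x\<in>insert ab {a, aab, aabab}. x * (ab ^ k * (aabab ^ k * (aab ^ k * (aaab ^ k * a ^ k)))) \<in> J"
    by (intro left_annihilated_insert nilpotent) (simp_all add: left_push)
  then have "\<forall>x\<in>insert b {a, ab}. x * (b ^ k * (ab ^ k * (aabab ^ k * (aab ^ k * (aaab ^ k * a ^ k))))) \<in> J"
    by (intro left_annihilated_insert nilpotent) (simp_all add: left_push)
  then show "a * root_product k \<in> J" "b * root_product k \<in> J"
    unfolding root_product_def mult.assoc by auto
qed

end

end

section \<open>The free algebra and its counit\<close>

lemma ring_ring_of_class: "ring (ring_of_class :: 'a::ring_1 ring)"
proof (intro ringI abelian_groupI monoidI)
  fix x :: 'a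
  assume "x \<in> carrier ring_of_class"
  show "\<exists>y\<in>carrier ring_of_class. y \<oplus>\<^bsub>ring_of_class\<^esub> x = \<zero>\<^bsub>ring_of_class\<^esub>"
    by (rule bexI[of _ "- x"]) (simp_all add: ring_of_class_def)
qed (simp_all add: ring_of_class_def algebra_simps)

lemma ring_of_class_simps [simp]:
  "carrier (ring_of_class :: 'a::ring_1 ring) = UNIV"
  "x \<otimes>\<^bsub>ring_of_class\<^esub> y = x * (y::'a)"
  "x \<oplus>\<^bsub>ring_of_class\<^esub> y = x + (y::'a)"
  "\<one>\<^bsub>ring_of_class\<^esub> = (1::'a)"
  "\<zero>\<^bsub>ring_of_class\<^esub> = (0::'a)"
  by (simp_all add: ring_of_class_def)

lemma poly_mapping_eq_sum_single:
  "a = (\<Sum>u\<in>Poly_Mapping.keys a. Poly_Mapping.single u (Poly_Mapping.lookup a u))"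
  by (rule poly_mapping_eqI) (simp add: lookup_sum lookup_single when_def in_keys_iff)

lemma scalar_0 [simp]: "scalar 0 = 0"
  by (simp add: scalar_def)

lemma scalar_add: "scalar (x + y) = scalar x + scalar y"
  by (simp add: scalar_def single_add)

lemma scalar_sum: "scalar (\<Sum>i\<in>I. h i) = (\<Sum>i\<in>I. scalar (h i))"
  by (induction I rule: infinite_finite_induct) (simp_all add: scalar_add)

lemma scalar_mult: "scalar (x * y) = scalar x * scalar (y :: 'k::semiring_1)"
  by (simp add: scalar_def mult_single)

lemma scalar_1 [simp]: "scalar 1 = 1"
  by (simp add: scalar_def)

lemma scalar_central:
  fixes a :: "'m::monoid_add \<Rightarrow>\<^sub>0 'k::comm_semiring_1"
  shows "a * scalar c = scalar c * a"
proof -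
  have "Poly_Mapping.single u d * scalar c = scalar c * Poly_Mapping.single u d" for u :: 'm and d
    by (simp add: scalar_def mult_single mult.commute)
  then show ?thesis
    by (subst (1 2) poly_mapping_eq_sum_single[of a]) (simp add: sum_distrib_left sum_distrib_right)
qed

lemma scalar_left_central: "(a :: 'm::monoid_add \<Rightarrow>\<^sub>0 'k::comm_semiring_1) * (scalar c * b) = scalar c * (a * b)"
  by (metis scalar_central mult.assoc)

lemma single_eq_scalar_mult: "Poly_Mapping.single u c = scalar c * Poly_Mapping.single u (1 :: 'k::semiring_1)"
  by (simp add: scalar_def mult_single)

lemma single_Word_Cons:
  "Poly_Mapping.single (Word (g # l)) (1 :: 'k::semiring_1) = gen g * Poly_Mapping.single (Word l) 1"
  by (simp add: gen_def mult_single plus_word_def)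

lemma single_Word_Nil: "Poly_Mapping.single (Word []) 1 = 1"
  by (simp add: single_one[symmetric] zero_word_def del: single_one)

section \<open>Characters of monoid algebras and the counit\<close>

definition char_sum :: "('m \<Rightarrow> 'k) \<Rightarrow> ('m \<Rightarrow>\<^sub>0 'k::comm_ring_1) \<Rightarrow> 'k" where
  "char_sum \<chi> a = (\<Sum>u\<in>Poly_Mapping.keys a. Poly_Mapping.lookup a u * \<chi> u)"

text \<open>The supports of \<open>a\<close>, \<open>b\<close> and \<open>a + b\<close> differ;
  additivity needs one common index set for all three sums.\<close>

lemma char_sum_superset:
  assumes "finite K" "Poly_Mapping.keys a \<subseteq> K"
  shows "char_sum \<chi> a = (\<Sum>u\<in>K. Poly_Mapping.lookup a u * \<chi> u)"
  unfolding char_sum_def using assms by (intro sum.mono_neutral_left) (auto simp: in_keys_iff)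

lemma char_sum_0 [simp]: "char_sum \<chi> 0 = 0"
  by (simp add: char_sum_def)

lemma char_sum_add: "char_sum \<chi> (a + b) = char_sum \<chi> a + char_sum \<chi> b"
proof -
  let ?K = "Poly_Mapping.keys a \<union> Poly_Mapping.keys b"
  show ?thesis
    using keys_add[of a b]
    by (subst (1 2 3) char_sum_superset[of ?K])
       (auto simp: lookup_add algebra_simps sum.distrib)
qed

lemma char_sum_sum: "char_sum \<chi> (\<Sum>i\<in>I. h i) = (\<Sum>i\<in>I. char_sum \<chi> (h i))"
  by (induction I rule: infinite_finite_induct) (simp_all add: char_sum_add)

lemma char_sum_single: "char_sum \<chi> (Poly_Mapping.single u c) = c * \<chi> u"
  by (simp add: char_sum_def)

lemma char_sum_mult:
  assumes "\<And>u v. \<chi> (u + v) = \<chi> u * \<chi> v"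
  shows "char_sum \<chi> (a * b) = char_sum \<chi> a * char_sum \<chi> b"
proof -
  have "char_sum \<chi> (a * b) = (\<Sum>u\<in>Poly_Mapping.keys a. \<Sum>v\<in>Poly_Mapping.keys b.
      char_sum \<chi> (Poly_Mapping.single u (Poly_Mapping.lookup a u) * Poly_Mapping.single v (Poly_Mapping.lookup b v)))"
    by (subst (1) poly_mapping_eq_sum_single[of a], subst (1) poly_mapping_eq_sum_single[of b])
       (simp add: sum_product char_sum_sum)
  also have "\<dots> = char_sum \<chi> a * char_sum \<chi> b"
    by (simp add: mult_single char_sum_single assms)
       (simp add: char_sum_def sum_product algebra_simps)
  finally show ?thesis .
qed

abbreviation counit_gen :: "generator \<Rightarrow> 'k::field" where
  "counit_gen g \<equiv> (case g of Gen_e i \<Rightarrow> 0 | Gen_f i \<Rightarrow> 0 | _ \<Rightarrow> 1)"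

lemma counit_eq_char_sum: "counit = char_sum (\<lambda>u. prod_list (map counit_gen (letters u)))"
  by (simp add: fun_eq_iff counit_def hom_ext_def char_sum_def)

lemma counit_add: "counit (a + b) = counit a + counit b"
  by (simp add: counit_eq_char_sum char_sum_add)

lemma counit_mult: "counit (a * b) = counit a * counit b"
  by (simp add: counit_eq_char_sum char_sum_mult plus_word_def)

lemma counit_scalar: "counit (scalar c) = c"
  by (simp add: counit_eq_char_sum scalar_def char_sum_single zero_word_def)

lemma counit_0 [simp]: "counit 0 = 0"
  by (simp add: counit_eq_char_sum)

lemma counit_1 [simp]: "counit 1 = 1"
  using counit_scalar[of 1] by simp

lemma counit_uminus: "counit (- a) = - counit a"
  using counit_add[of a "- a"] by (simp add: eq_neg_iff_add_eq_0 add.commute)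

lemma counit_diff: "counit (a - b) = counit a - counit b"
  using counit_add[of a "- b"] counit_uminus[of b] by simp

lemma counit_power: "counit (a ^ n) = counit a ^ n"
  by (induction n) (simp_all add: counit_mult)

lemma counit_smul: "counit (c \<bullet> a) = c * counit a"
  by (simp add: smul_def counit_mult counit_scalar)

lemma counit_gen: "counit (gen g) = counit_gen g"
  by (simp add: counit_eq_char_sum gen_def char_sum_single)

lemmas counit_simps = counit_add counit_mult counit_diff counit_power counit_smul counit_gen
  e_def f_def w_def w_inv_def w'_def w'_inv_def

lemma counit_G2_rels: "a \<in> G2_rels r s \<Longrightarrow> counit a = 0"
proof -
  assume "a \<in> G2_rels r s"
  then show ?thesis
    unfolding G2_rels_def torus_rels_def weight_rels_def cross_rels_def serre_rels_def Let_def
    by (auto simp: counit_simps split: if_splits)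
qed

lemma counit_root_vectors: "a \<in> root_vectors r s \<Longrightarrow> counit a = 0"
  by (auto simp: root_vectors_def E1_def E2_def F1_def F2_def E12_def E112_def E1112_def E11212_def
      F12_def F112_def F1112_def F11212_def counit_simps)

section \<open>The kernel of the projection\<close>

lemma ideal_ker_counit: "ideal {a. counit a = (0::'k::field)} ring_of_class"
proof -
  interpret ring "ring_of_class :: 'k free_G2 ring" by (rule ring_ring_of_class)
  show ?thesis
  proof (rule idealI[OF ring_axioms])
    show "subgroup {a. counit a = (0::'k)} (add_monoid ring_of_class)"
    proof (rule add.subgroupI)
      fix a assume "a \<in> {a. counit a = (0::'k)}"
      moreover have "\<ominus>\<^bsub>ring_of_class\<^esub> a = - a"
        by (rule minus_equality) simp_all
      ultimately show "\<ominus>\<^bsub>ring_of_class\<^esub> a \<in> {a. counit a = (0::'k)}"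
        by (simp add: counit_uminus)
    qed (auto simp: counit_add intro: exI[of _ 0])
  qed (simp_all add: counit_mult)
qed

context
  fixes r s :: "'k::field" and ell :: nat
begin

interpretation T: ring "ring_of_class :: 'k free_G2 ring" by (rule ring_ring_of_class)

lemma ideal_G2_rels: "ideal (genideal ring_of_class (G2_rels r s)) ring_of_class"
  by (rule T.genideal_ideal) simp

lemma to_U_hom: "to_U r s \<in> ring_hom ring_of_class (U_G2 r s)"
proof -
  have "to_U r s = (+>\<^bsub>ring_of_class\<^esub>) (genideal ring_of_class (G2_rels r s))"
    by (simp add: fun_eq_iff to_U_def)
  then show ?thesis
    using ideal.rcos_ring_hom[OF ideal_G2_rels] by (simp add: U_G2_def)
qed

lemma ring_U_G2: "ring (U_G2 r s)"
  unfolding U_G2_def by (rule ideal.quotient_is_ring[OF ideal_G2_rels])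

lemma carrier_U_G2: "carrier (U_G2 r s) = range (to_U r s)"
  by (auto simp: U_G2_def to_U_def FactRing_def A_RCOSETS_def')

lemma ideal_restricted: "ideal (restricted_ideal r s ell) (U_G2 r s)"
  unfolding restricted_ideal_def
  by (rule ring.genideal_ideal[OF ring_U_G2]) (auto simp: carrier_U_G2)

lemma to_u_hom: "to_u r s ell \<in> ring_hom ring_of_class (u_G2 r s ell)"
proof -
  have "to_u r s ell = (+>\<^bsub>U_G2 r s\<^esub>) (restricted_ideal r s ell) \<circ> to_U r s"
    by (simp add: fun_eq_iff to_u_def)
  then show ?thesis
    using ring_hom_trans[OF to_U_hom ideal.rcos_ring_hom[OF ideal_restricted]] by (simp add: u_G2_def)
qed

lemma ring_u_G2: "ring (u_G2 r s ell)"
  unfolding u_G2_def by (rule ideal.quotient_is_ring[OF ideal_restricted])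

lemma carrier_u_G2: "carrier (u_G2 r s ell) = range (to_u r s ell)"
  by (auto simp: u_G2_def to_u_def FactRing_def A_RCOSETS_def' carrier_U_G2)

lemma to_u_add: "to_u r s ell (a + b) = to_u r s ell a \<oplus>\<^bsub>u_G2 r s ell\<^esub> to_u r s ell b"
  using ring_hom_add[OF to_u_hom, of a b] by simp

lemma to_u_mult: "to_u r s ell (a * b) = to_u r s ell a \<otimes>\<^bsub>u_G2 r s ell\<^esub> to_u r s ell b"
  using ring_hom_mult[OF to_u_hom, of a b] by simp

lemma to_u_1: "to_u r s ell 1 = \<one>\<^bsub>u_G2 r s ell\<^esub>"
  using ring_hom_one[OF to_u_hom] by simp

lemma to_u_0: "to_u r s ell 0 = \<zero>\<^bsub>u_G2 r s ell\<^esub>"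
  using ring_hom_zero[OF to_u_hom T.ring_axioms ring_u_G2] by simp

lemma to_u_uminus: "to_u r s ell (- a) = \<ominus>\<^bsub>u_G2 r s ell\<^esub> to_u r s ell a"
proof -
  interpret u: ring "u_G2 r s ell" by (rule ring_u_G2)
  show ?thesis
    by (rule u.minus_equality[symmetric]) (simp_all add: to_u_add[symmetric] to_u_0[symmetric] carrier_u_G2)
qed

definition relations_ideal :: "'k free_G2 set" where
  "relations_ideal = {a. to_u r s ell a = \<zero>\<^bsub>u_G2 r s ell\<^esub>}"

text \<open>Reduces equations in the two-stage quotient to membership in one ideal of the free
  algebra, where the simplifier can compute.\<close>

lemma to_u_eq_iff: "to_u r s ell a = to_u r s ell b \<longleftrightarrow> a - b \<in> relations_ideal"
proof -
  interpret u: ring "u_G2 r s ell" by (rule ring_u_G2)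
  have "to_u r s ell a \<in> carrier (u_G2 r s ell)" "to_u r s ell b \<in> carrier (u_G2 r s ell)"
    by (simp_all add: carrier_u_G2)
  moreover have "to_u r s ell (a - b) = to_u r s ell a \<ominus>\<^bsub>u_G2 r s ell\<^esub> to_u r s ell b"
    using to_u_add[of a "- b"] by (simp add: to_u_uminus u.minus_eq)
  ultimately show ?thesis
    by (simp add: relations_ideal_def)
qed

lemma two_sided_ideal_relations:
  "0 \<in> relations_ideal"
  "a \<in> relations_ideal \<Longrightarrow> b \<in> relations_ideal \<Longrightarrow> a + b \<in> relations_ideal"
  "a \<in> relations_ideal \<Longrightarrow> c * a \<in> relations_ideal"
  "a \<in> relations_ideal \<Longrightarrow> a * c \<in> relations_ideal"
proof -
  interpret u: ring "u_G2 r s ell" by (rule ring_u_G2)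
  have "to_u r s ell c \<in> carrier (u_G2 r s ell)" for c
    by (simp add: carrier_u_G2)
  then show "0 \<in> relations_ideal"
    "a \<in> relations_ideal \<Longrightarrow> b \<in> relations_ideal \<Longrightarrow> a + b \<in> relations_ideal"
    "a \<in> relations_ideal \<Longrightarrow> c * a \<in> relations_ideal"
    "a \<in> relations_ideal \<Longrightarrow> a * c \<in> relations_ideal"
    by (simp_all add: relations_ideal_def to_u_add to_u_mult to_u_0)
qed

lemma zero_u_G2: "\<zero>\<^bsub>u_G2 r s ell\<^esub> = restricted_ideal r s ell"
  by (simp add: u_G2_def FactRing_def)

lemma zero_U_G2: "\<zero>\<^bsub>U_G2 r s\<^esub> = genideal ring_of_class (G2_rels r s)"
  by (simp add: U_G2_def FactRing_def)

lemma mem_relations_ideal_iff: "a \<in> relations_ideal \<longleftrightarrow> to_U r s a \<in> restricted_ideal r s ell"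
proof -
  interpret I: ideal "restricted_ideal r s ell" "U_G2 r s" by (rule ideal_restricted)
  have c: "to_U r s a \<in> carrier (U_G2 r s)" by (simp add: carrier_U_G2)
  show ?thesis
    unfolding relations_ideal_def zero_u_G2 to_u_def mem_Collect_eq
    using c I.rcos_const_imp_mem I.a_rcos_const by blast
qed

lemma G2_rels_mem: "a \<in> G2_rels r s \<Longrightarrow> a \<in> relations_ideal"
proof -
  interpret I: ideal "genideal ring_of_class (G2_rels r s)" "ring_of_class :: 'k free_G2 ring"
    by (rule ideal_G2_rels)
  interpret K: ideal "restricted_ideal r s ell" "U_G2 r s" by (rule ideal_restricted)
  assume "a \<in> G2_rels r s"
  then have "a \<in> genideal ring_of_class (G2_rels r s)"
    using T.genideal_self[of "G2_rels r s"] by auto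
  then have "to_U r s a = \<zero>\<^bsub>U_G2 r s\<^esub>"
    unfolding to_U_def zero_U_G2 by (rule I.a_rcos_const)
  then show ?thesis by (simp add: mem_relations_ideal_iff)
qed

lemma restricted_rels_mem:
  "a \<in> (\<lambda>a. a ^ ell) ` root_vectors r s \<union> range (\<lambda>k. w k ^ ell - 1) \<union> range (\<lambda>k. w' k ^ ell - 1)
    \<Longrightarrow> a \<in> relations_ideal"
  unfolding mem_relations_ideal_iff restricted_ideal_def
  by (rule subsetD[OF ring.genideal_self[OF ring_U_G2]]) (auto simp: carrier_U_G2)

text \<open>The kernel of the counit contains the relations of the first quotient, and its image in
  \<open>U_G2\<close> is an ideal containing those of the second. So \<open>a\<close> has the class
  in \<open>U_G2\<close> of some \<open>k\<close> with counit zero, and differs from it by an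
  element of the first ideal.\<close>

lemma counit_relations_ideal:
  assumes "ell > 0" and "a \<in> relations_ideal"
  shows "counit a = 0"
proof -
  interpret I: ideal "genideal ring_of_class (G2_rels r s)" "ring_of_class :: 'k free_G2 ring"
    by (rule ideal_G2_rels)
  have I_ker: "genideal ring_of_class (G2_rels r s) \<subseteq> {a. counit a = 0}"
    by (rule T.genideal_minimal[OF ideal_ker_counit]) (auto simp: counit_G2_rels)
  have "ideal (to_U r s ` {a. counit a = 0}) (U_G2 r s)"
    using T.ring_ideal_imp_quot_ideal[OF ideal_G2_rels ideal_ker_counit]
    by (simp add: U_G2_def to_U_def image_def)
  then have "restricted_ideal r s ell \<subseteq> to_U r s ` {a. counit a = 0}"
    unfolding restricted_ideal_def
    by (rule ring.genideal_minimal[OF ring_U_G2], intro image_mono)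
       \<comment> \<open>Positivity of \<open>ell\<close> gives \<open>0 ^ ell = 0\<close> for the
         powers of the root vectors.\<close>
       (use assms(1) in \<open>auto simp: counit_diff counit_power counit_root_vectors w_def w'_def counit_gen\<close>)
  then obtain k where k: "counit k = 0" "to_U r s a = to_U r s k"
    using assms(2) by (auto simp: mem_relations_ideal_iff)
  have "a \<in> genideal ring_of_class (G2_rels r s) +>\<^bsub>ring_of_class\<^esub> k"
    using I.a_rcos_self[of a] k(2) by (simp add: to_U_def)
  then obtain i where "i \<in> genideal ring_of_class (G2_rels r s)" "a = i + k"
    by (auto simp: a_r_coset_def r_coset_def)
  then show ?thesis using I_ker k(1) by (auto simp: counit_add)
qed

text \<open>The counit is constant on the fibres of the projection, so \<open>the_elem\<close> is
  applied to a singleton.\<close>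

lemma induced_counit_to_u:
  assumes "ell > 0"
  shows "induced_counit (to_u r s ell) (to_u r s ell a) = counit a"
proof -
  have "counit b = counit a" if "to_u r s ell b = to_u r s ell a" for b
    using counit_relations_ideal[OF assms, of "b - a"] that by (simp add: to_u_eq_iff counit_diff)
  then have "counit ` {b. to_u r s ell b = to_u r s ell a} = {counit a}" by blast
  then show ?thesis by (simp add: induced_counit_def)
qed

end

section \<open>Subalgebras spanned by words\<close>

definition supported :: "'m set \<Rightarrow> ('m \<Rightarrow>\<^sub>0 'k::zero) set" where
  "supported W = {a. Poly_Mapping.keys a \<subseteq> W}"

text \<open>The span of a submonoid is a subalgebra; this serves words as well as pairs of words.
  The type argument fixes the coefficient field for all facts at once.\<close>

locale submonoid_support =
  fixes W :: "'m::monoid_add set" and coefficient_type :: "'k::comm_ring_1 itself"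
  assumes zero_in: "0 \<in> W" and plus_in: "\<lbrakk>u \<in> W; v \<in> W\<rbrakk> \<Longrightarrow> u + v \<in> W"
begin

lemma supported_0: "0 \<in> supported W"
  by (simp add: supported_def)

lemma supported_scalar: "scalar (c::'k) \<in> supported W"
  by (simp add: supported_def scalar_def zero_in)

lemma supported_1: "(1 :: 'm \<Rightarrow>\<^sub>0 'k) \<in> supported W"
  using supported_scalar[of 1] by simp

lemma supported_add: "(a :: 'm \<Rightarrow>\<^sub>0 'k) \<in> supported W \<Longrightarrow> b \<in> supported W \<Longrightarrow> a + b \<in> supported W"
  using keys_add[of a b] by (auto simp: supported_def)

lemma supported_uminus: "(a :: 'm \<Rightarrow>\<^sub>0 'k) \<in> supported W \<Longrightarrow> - a \<in> supported W"
  by (simp add: supported_def)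

lemma supported_diff: "(a :: 'm \<Rightarrow>\<^sub>0 'k) \<in> supported W \<Longrightarrow> b \<in> supported W \<Longrightarrow> a - b \<in> supported W"
  using supported_add[of a "- b"] supported_uminus[of b] by simp

lemma supported_mult: "(a :: 'm \<Rightarrow>\<^sub>0 'k) \<in> supported W \<Longrightarrow> b \<in> supported W \<Longrightarrow> a * b \<in> supported W"
  unfolding supported_def using keys_mult[of a b] plus_in by fastforce

lemma supported_smul: "(a :: 'm \<Rightarrow>\<^sub>0 'k) \<in> supported W \<Longrightarrow> c \<bullet> a \<in> supported W"
  by (simp add: smul_def supported_mult supported_scalar)

lemma supported_power: "(a :: 'm \<Rightarrow>\<^sub>0 'k) \<in> supported W \<Longrightarrow> a ^ k \<in> supported W"
  by (induction k) (simp_all add: supported_1 supported_mult)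

lemma supported_sum: "(\<And>i. i \<in> I \<Longrightarrow> (h i :: 'm \<Rightarrow>\<^sub>0 'k) \<in> supported W) \<Longrightarrow> (\<Sum>i\<in>I. h i) \<in> supported W"
  by (induction I rule: infinite_finite_induct) (simp_all add: supported_0 supported_add)

lemma supported_prod_list:
  "(\<And>i. i \<in> set l \<Longrightarrow> (h i :: 'm \<Rightarrow>\<^sub>0 'k) \<in> supported W) \<Longrightarrow> prod_list (map h l) \<in> supported W"
  by (induction l) (simp_all add: supported_1 supported_mult)

lemmas supported_intros = supported_0 supported_scalar supported_1 supported_add supported_uminus
  supported_diff supported_mult supported_smul supported_power supported_sum supported_prod_list

end

definition words_over :: "'g set \<Rightarrow> 'g word set" where
  "words_over G = {u. set (letters u) \<subseteq> G}"

lemma submonoid_words_over: "submonoid_support (words_over G)"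
  by standard (simp_all add: words_over_def zero_word_def plus_word_def)

lemma submonoid_words_over2: "submonoid_support (words_over G \<times> words_over G)"
  by standard (auto simp: words_over_def zero_word_def plus_word_def zero_prod_def)

lemma supported_gen: "g \<in> G \<Longrightarrow> gen g \<in> supported (words_over G)"
  by (simp add: supported_def gen_def words_over_def)

lemma tens_supported:
  assumes "a \<in> supported V" "b \<in> supported W"
  shows "tens a b \<in> supported (V \<times> W)"
proof -
  have "Poly_Mapping.keys (tens a b) \<subseteq> (\<Union>u\<in>Poly_Mapping.keys a. \<Union>v\<in>Poly_Mapping.keys b. {(u, v)})"
    unfolding tens_def by (rule order_trans[OF keys_sum], intro UN_mono order_refl
      order_trans[OF keys_sum]) auto
  then show ?thesis using assms by (auto simp: supported_def)
qed

lemma single_Pair_eq_tens: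
  "Poly_Mapping.single (u, v) (c::'k::semiring_1) = tens (Poly_Mapping.single u c) (Poly_Mapping.single v 1)"
  by (simp add: tens_def)

text \<open>Each basis term of \<open>z\<close> is a pure tensor whose coefficient is absorbed into
  the left factor. This suits \<open>sub_tensor\<close>, which is generated as an additive
  group.\<close>

lemma to_tensor_square_mem:
  fixes \<pi> :: "('g, 'k::field) free_alg \<Rightarrow> 'a"
  assumes z: "z \<in> supported (W \<times> W)" and B: "\<pi> ` supported W \<subseteq> B"
  shows "to_tensor_square A \<pi> z \<in> sub_tensor A \<pi> B"
proof -
  interpret T: ring "ring_of_class :: ('g, 'k) free_alg2 ring" by (rule ring_ring_of_class)
  have I: "ideal (tensor_ideal A \<pi>) ring_of_class"
    unfolding tensor_ideal_def by (rule T.genideal_ideal) simp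
  have hom: "to_tensor_square A \<pi> \<in> ring_hom ring_of_class (tensor_square A \<pi>)"
  proof -
    have "to_tensor_square A \<pi> = (+>\<^bsub>ring_of_class\<^esub>) (tensor_ideal A \<pi>)"
      by (simp add: fun_eq_iff to_tensor_square_def)
    then show ?thesis
      using ideal.rcos_ring_hom[OF I] by (simp add: tensor_square_def)
  qed
  have sum: "to_tensor_square A \<pi> (\<Sum>i\<in>K. h i) \<in> sub_tensor A \<pi> B"
    if "\<And>i. i \<in> K \<Longrightarrow> to_tensor_square A \<pi> (h i) \<in> sub_tensor A \<pi> B" for K :: "('g word \<times> 'g word) set" and h
    using that
  proof (induction K rule: infinite_finite_induct)
    case (insert i K)
    then have "to_tensor_square A \<pi> (h i) \<oplus>\<^bsub>tensor_square A \<pi>\<^esub> to_tensor_square A \<pi> (sum h K)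
        \<in> sub_tensor A \<pi> B"
      unfolding sub_tensor_def
      using generate.eng[of _ "add_monoid (tensor_square A \<pi>)"] by simp
    then show ?case
      using insert.hyps ring_hom_add[OF hom, of "h i" "sum h K"] by simp
  qed (use ring_hom_zero[OF hom T.ring_axioms] ideal.quotient_is_ring[OF I]
        generate.one[of "add_monoid (tensor_square A \<pi>)"]
      in \<open>simp_all add: sub_tensor_def tensor_square_def\<close>)
  have "to_tensor_square A \<pi> (Poly_Mapping.single i (Poly_Mapping.lookup z i)) \<in> sub_tensor A \<pi> B"
    if i: "i \<in> Poly_Mapping.keys z" for i
  proof -
    obtain u v where uv: "i = (u, v)" "u \<in> W" "v \<in> W"
      using z i by (auto simp: supported_def)
    have "Poly_Mapping.single u c \<in> supported W" "Poly_Mapping.single v c \<in> supported W" for c :: 'k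
      using uv by (simp_all add: supported_def)
    then have "\<pi> (Poly_Mapping.single u (Poly_Mapping.lookup z i)) \<in> B" "\<pi> (Poly_Mapping.single v 1) \<in> B"
      using B by blast+
    then show ?thesis
      unfolding uv(1) single_Pair_eq_tens sub_tensor_def
      by (intro generate.incl) (use uv(1) in blast)
  qed
  then show ?thesis
    by (subst poly_mapping_eq_sum_single) (rule sum)
qed

text \<open>If every letter acts on \<open>y\<close> by a scalar, so does every word, by induction,
  and every combination, by linearity. The integral property thus has to be checked only on
  generators.\<close>

lemma character_left:
  fixes y :: "('g, 'k::field) free_alg"
  assumes "two_sided_ideal J"
    and gens: "\<And>g. g \<in> G \<Longrightarrow> gen g * y - scalar (\<chi> g) * y \<in> J"
    and a: "a \<in> supported (words_over G)"
  shows "a * y - scalar (char_sum (\<lambda>u. prod_list (map \<chi> (letters u))) a) * y \<in> J"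
proof -
  interpret two_sided_ideal J by fact
  let ?\<chi> = "\<lambda>u. prod_list (map \<chi> (letters u))"
  have word: "Poly_Mapping.single (Word l) 1 * y - scalar (prod_list (map \<chi> l)) * y \<in> J"
    if "set l \<subseteq> G" for l
    using that
  proof (induction l)
    case (Cons g l)
    let ?W = "Poly_Mapping.single (Word l) (1::'k)" and ?c = "scalar (prod_list (map \<chi> l))"
    \<comment> \<open>Replace \<open>?W * y\<close> by \<open>?c * y\<close> behind
      \<open>gen g\<close>, then \<open>gen g * y\<close> by its scalar multiple of
      \<open>y\<close>.\<close>
    have "gen g * ?W * y - scalar (\<chi> g * prod_list (map \<chi> l)) * y
        = gen g * (?W * y - ?c * y) + ?c * (gen g * y - scalar (\<chi> g) * y)"
      by (subst mult.commute[of "\<chi> g"]) (simp add: scalar_mult right_diff_distrib scalar_left_central[of "gen g"] mult.assoc)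
    also have "\<dots> \<in> J"
      using Cons gens[of g] by (intro add_mem lmult_mem rmult_mem) simp_all
    finally show ?case by (simp add: single_Word_Cons)
  qed (simp add: single_Word_Nil)
  have "a * y - scalar (char_sum ?\<chi> a) * y = (\<Sum>u\<in>Poly_Mapping.keys a.
      scalar (Poly_Mapping.lookup a u) * (Poly_Mapping.single u 1 * y - scalar (?\<chi> u) * y))"
  proof -
    have "a * y = (\<Sum>u\<in>Poly_Mapping.keys a. scalar (Poly_Mapping.lookup a u) * Poly_Mapping.single u 1) * y"
      using poly_mapping_eq_sum_single[of a] by (simp only: flip: single_eq_scalar_mult)
    moreover have "scalar (char_sum ?\<chi> a) = (\<Sum>u\<in>Poly_Mapping.keys a.
        scalar (Poly_Mapping.lookup a u) * scalar (?\<chi> u) :: ('g, 'k) free_alg)"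
      by (simp add: char_sum_def scalar_sum scalar_mult)
    ultimately show ?thesis
      by (simp add: sum_distrib_right sum_subtractf right_diff_distrib mult.assoc)
  qed
  also have "\<dots> \<in> J"
  proof (rule sum_mem, rule lmult_mem)
    fix u assume "u \<in> Poly_Mapping.keys a"
    then have "set (letters u) \<subseteq> G" using a by (auto simp: supported_def words_over_def)
    from word[OF this] show "Poly_Mapping.single u 1 * y - scalar (?\<chi> u) * y \<in> J" by simp
  qed
  finally show ?thesis .
qed

lemma character_right:
  fixes y :: "('g, 'k::field) free_alg"
  assumes "two_sided_ideal J"
    and gens: "\<And>g. g \<in> G \<Longrightarrow> y * gen g - scalar (\<chi> g) * y \<in> J"
    and a: "a \<in> supported (words_over G)"
  shows "y * a - scalar (char_sum (\<lambda>u. prod_list (map \<chi> (letters u))) a) * y \<in> J"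
proof -
  interpret two_sided_ideal J by fact
  let ?\<chi> = "\<lambda>u. prod_list (map \<chi> (letters u))"
  have word: "y * Poly_Mapping.single (Word l) 1 - scalar (prod_list (map \<chi> l)) * y \<in> J"
    if "set l \<subseteq> G" for l
    using that
  proof (induction l)
    case (Cons g l)
    let ?W = "Poly_Mapping.single (Word l) (1::'k)" and ?c = "scalar (prod_list (map \<chi> l))"
    have "y * (gen g * ?W) - scalar (\<chi> g * prod_list (map \<chi> l)) * y
        = (y * gen g - scalar (\<chi> g) * y) * ?W + scalar (\<chi> g) * (y * ?W - ?c * y)"
      by (simp add: algebra_simps scalar_mult)
    also have "\<dots> \<in> J"
      using Cons gens[of g] by (intro add_mem lmult_mem rmult_mem) simp_all
    finally show ?case by (simp add: single_Word_Cons)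
  qed (simp add: single_Word_Nil)
  have "y * a - scalar (char_sum ?\<chi> a) * y = (\<Sum>u\<in>Poly_Mapping.keys a.
      scalar (Poly_Mapping.lookup a u) * (y * Poly_Mapping.single u 1 - scalar (?\<chi> u) * y))"
  proof -
    have "y * a = y * (\<Sum>u\<in>Poly_Mapping.keys a. scalar (Poly_Mapping.lookup a u) * Poly_Mapping.single u 1)"
      using poly_mapping_eq_sum_single[of a] by (simp only: flip: single_eq_scalar_mult)
    moreover have "scalar (char_sum ?\<chi> a) = (\<Sum>u\<in>Poly_Mapping.keys a.
        scalar (Poly_Mapping.lookup a u) * scalar (?\<chi> u) :: ('g, 'k) free_alg)"
      by (simp add: char_sum_def scalar_sum scalar_mult)
    ultimately show ?thesis
      by (simp add: sum_distrib_left sum_distrib_right sum_subtractf right_diff_distrib mult.assoc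
          scalar_left_central[of y])
  qed
  also have "\<dots> \<in> J"
  proof (rule sum_mem, rule lmult_mem)
    fix u assume "u \<in> Poly_Mapping.keys a"
    then have "set (letters u) \<subseteq> G" using a by (auto simp: supported_def words_over_def)
    from word[OF this] show "y * Poly_Mapping.single u 1 - scalar (?\<chi> u) * y \<in> J" by simp
  qed
  finally show ?thesis .
qed

section \<open>The Borel subalgebra\<close>

abbreviation borel_gens :: "generator set" where
  "borel_gens \<equiv> range Gen_e \<union> range Gen_w \<union> range Gen_w_inv"

context
  fixes r s :: "'k::field" and ell :: nat
begin

abbreviation borel_words :: "generator word set" where "borel_words \<equiv> words_over borel_gens"

interpretation S: submonoid_support borel_words "TYPE('k)"
  by (rule submonoid_words_over)

interpretation S2: submonoid_support "borel_words \<times> borel_words" "TYPE('k)"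
  by (rule submonoid_words_over2)

interpretation u: ring "u_G2 r s ell" by (rule ring_u_G2)

lemma borel_gens_supported:
  "e i \<in> supported borel_words" "w i \<in> supported borel_words" "w_inv i \<in> supported borel_words"
  by (simp_all add: e_def w_def w_inv_def supported_gen)

lemma subring_borel: "subring (to_u r s ell ` supported borel_words) (u_G2 r s ell)"
proof (rule u.subringI)
  show "to_u r s ell ` supported borel_words \<subseteq> carrier (u_G2 r s ell)"
    by (auto simp: carrier_u_G2)
  show "\<one>\<^bsub>u_G2 r s ell\<^esub> \<in> to_u r s ell ` supported borel_words"
    using S.supported_1 by (auto simp flip: to_u_1)
next
  fix X assume "X \<in> to_u r s ell ` supported borel_words"
  then obtain a where "X = to_u r s ell a" "a \<in> supported borel_words" by blast
  then show "\<ominus>\<^bsub>u_G2 r s ell\<^esub> X \<in> to_u r s ell ` supported borel_words"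
    by (simp only: to_u_uminus[symmetric] imageI S.supported_uminus)
next
  fix X Y assume "X \<in> to_u r s ell ` supported borel_words" "Y \<in> to_u r s ell ` supported borel_words"
  then obtain a b where "X = to_u r s ell a" "a \<in> supported borel_words" "Y = to_u r s ell b" "b \<in> supported borel_words"
    by blast
  then show "X \<otimes>\<^bsub>u_G2 r s ell\<^esub> Y \<in> to_u r s ell ` supported borel_words"
    "X \<oplus>\<^bsub>u_G2 r s ell\<^esub> Y \<in> to_u r s ell ` supported borel_words"
    by (simp_all only: to_u_add[symmetric] to_u_mult[symmetric] imageI S.supported_mult S.supported_add)
qed

text \<open>Comultiplication and antipode send each Borel letter to a combination of Borel words or
  pairs of them, hence so do their extensions to words; the reversal in the antipode keeps the
  letters.\<close>

lemma hopf_subalgebra_borel: "hopf_subalgebra (u_G2 r s ell) (to_u r s ell) (to_u r s ell ` supported borel_words)"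
  unfolding hopf_subalgebra_def
proof (intro conjI ballI)
  show "range (\<lambda>c. to_u r s ell (scalar c)) \<subseteq> to_u r s ell ` supported borel_words"
    using S.supported_scalar by blast
next
  fix X assume "X \<in> to_u r s ell ` supported borel_words"
  then obtain a where a: "X = to_u r s ell a" "a \<in> supported borel_words" by blast
  have letters: "set (letters u) \<subseteq> borel_gens" if "u \<in> Poly_Mapping.keys a" for u
    using a(2) that by (auto simp: supported_def words_over_def)
  have comult_e: "tens (e i) 1 + tens (w i) (e i :: 'k free_G2) \<in> supported (borel_words \<times> borel_words)" for i
    by (intro S2.supported_add tens_supported borel_gens_supported S.supported_1)
  have comult_w: "tens (gen g) (gen g :: 'k free_G2) \<in> supported (borel_words \<times> borel_words)"
    if "g \<in> borel_gens" for g
    by (intro tens_supported supported_gen that)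
  have "comult a \<in> supported (borel_words \<times> borel_words)"
    unfolding comult_def hom_ext_def
  proof (intro S2.supported_sum S2.supported_mult S2.supported_scalar S2.supported_prod_list)
    fix u g assume "u \<in> Poly_Mapping.keys a" "g \<in> set (letters u)"
    then have "g \<in> borel_gens" using letters by blast
    then show "(case g of Gen_e i \<Rightarrow> tens (e i) (1 :: 'k free_G2) + tens (w i) (e i)
        | Gen_f i \<Rightarrow> tens 1 (f i) + tens (f i) (w' i) | _ \<Rightarrow> tens (gen g) (gen g))
        \<in> supported (borel_words \<times> borel_words)"
      using comult_e comult_w[of g] by (elim UnE rangeE) simp_all
  qed
  then have "to_tensor_square (u_G2 r s ell) (to_u r s ell) (comult a)
      \<in> sub_tensor (u_G2 r s ell) (to_u r s ell) (to_u r s ell ` supported borel_words)"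
    by (rule to_tensor_square_mem) (rule subset_refl)
  then show "\<exists>Z\<in>sub_tensor (u_G2 r s ell) (to_u r s ell) (to_u r s ell ` supported borel_words).
      (X, Z) \<in> comult_graph (u_G2 r s ell) (to_u r s ell)"
    unfolding a(1) comult_graph_def by (rule bexI[rotated]) (rule range_eqI[OF refl])
  have "antipode a \<in> supported borel_words"
    unfolding antipode_def antihom_ext_def
  proof (intro S.supported_sum S.supported_mult S.supported_scalar S.supported_prod_list)
    fix u g assume "u \<in> Poly_Mapping.keys a" "g \<in> set (rev (letters u))"
    then have "g \<in> borel_gens" using letters by auto
    then show "(case g of Gen_e i \<Rightarrow> - (w_inv i * (e i :: 'k free_G2)) | Gen_f i \<Rightarrow> - (f i * w'_inv i)
        | Gen_w i \<Rightarrow> w_inv i | Gen_w_inv i \<Rightarrow> w i | Gen_w' i \<Rightarrow> w'_inv i | Gen_w'_inv i \<Rightarrow> w' i)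
        \<in> supported borel_words"
      by (auto intro!: S.supported_intros borel_gens_supported)
  qed
  then show "\<exists>Y\<in>to_u r s ell ` supported borel_words. (X, Y) \<in> antipode_graph (to_u r s ell)"
    unfolding a(1) antipode_graph_def
    by (intro bexI[of _ "to_u r s ell (antipode a)"] range_eqI[OF refl] imageI)
qed (rule subring_borel)

text \<open>Words come from closure under products, combinations from scalars and sums. This is the
  minimality half of \<open>carrier_borel\<close>.\<close>

lemma supported_mem_subring:
  assumes B: "subring B (u_G2 r s ell)" and scalars: "range (\<lambda>c. to_u r s ell (scalar c)) \<subseteq> B"
    and gens: "\<And>g. g \<in> G \<Longrightarrow> to_u r s ell (gen g) \<in> B"
    and a: "a \<in> supported (words_over G)"
  shows "to_u r s ell a \<in> B"
proof -
  have word: "to_u r s ell (Poly_Mapping.single (Word l) 1) \<in> B" if "set l \<subseteq> G" for l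
    using that
    by (induction l)
       (simp_all add: single_Word_Nil single_Word_Cons to_u_1 to_u_mult subringE[OF B] gens)
  have "to_u r s ell (\<Sum>u\<in>K. Poly_Mapping.single u (Poly_Mapping.lookup a u)) \<in> B"
    if "K \<subseteq> Poly_Mapping.keys a" for K
    using finite_subset[OF that finite_keys] that
  proof (induction K rule: finite_induct)
    case (insert u K)
    have "set (letters u) \<subseteq> G" using a insert.prems by (auto simp: supported_def words_over_def)
    from word[OF this] scalars have "to_u r s ell (Poly_Mapping.single u (Poly_Mapping.lookup a u)) \<in> B"
      by (subst single_eq_scalar_mult) (auto simp: to_u_mult intro: subringE(6)[OF B])
    with insert show ?case by (simp add: to_u_add subringE(7)[OF B])
  qed (simp add: to_u_0 subringE[OF B])
  then show ?thesis by (subst poly_mapping_eq_sum_single) blast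
qed

text \<open>The image of the Borel words is itself a Hopf subalgebra and lies in every competitor,
  so the intersection is attained. Elements of the Borel algebra thus have representatives free of
  \<open>f\<close> and \<open>w'\<close>.\<close>

lemma carrier_borel: "carrier (borel r s ell) = to_u r s ell ` supported borel_words"
proof -
  let ?S = "to_u r s ell ` (range e \<union> range w \<union> range w_inv)"
  have "range e \<union> range w \<union> range w_inv \<subseteq> (supported borel_words :: 'k free_G2 set)"
    by (auto simp: borel_gens_supported)
  then have "?S \<subseteq> to_u r s ell ` supported borel_words"
    by (rule image_mono)
  moreover have "to_u r s ell ` supported borel_words \<subseteq> B"
    if B: "hopf_subalgebra (u_G2 r s ell) (to_u r s ell) B" "?S \<subseteq> B" for B
  proof (rule image_subsetI)
    have "subring B (u_G2 r s ell)" "range (\<lambda>c. to_u r s ell (scalar c)) \<subseteq> B"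
      using B(1) unfolding hopf_subalgebra_def by blast+
    moreover have "to_u r s ell (gen g) \<in> B" if "g \<in> borel_gens" for g
    proof -
      have "gen g \<in> range e \<union> range w \<union> range w_inv"
        using that by (auto simp: e_def w_def w_inv_def)
      from subsetD[OF B(2) imageI[OF this]] show ?thesis .
    qed
    ultimately show "to_u r s ell a \<in> B" if "a \<in> supported borel_words" for a
      using that by (rule supported_mem_subring)
  qed
  ultimately have "hopf_subalgebra_generated (u_G2 r s ell) (to_u r s ell) ?S = to_u r s ell ` supported borel_words"
    unfolding hopf_subalgebra_generated_def
    by (intro antisym Inter_lower Inter_greatest) (simp_all add: hopf_subalgebra_borel)
  then show ?thesis by (simp add: borel_def)
qed

lemma elt_t_supported: "elt_t ell \<in> (supported borel_words :: 'k free_G2 set)"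
  unfolding elt_t_def by (intro S.supported_intros borel_gens_supported)

lemma elt_x_supported: "elt_x r s ell \<in> supported borel_words"
  unfolding elt_x_def E1_def E2_def E12_def E112_def E1112_def E11212_def
  by (intro S.supported_intros borel_gens_supported)

end

section \<open>The integrals\<close>

context
  fixes r s :: "'k::field" and ell :: nat
  assumes r_root: "r ^ ell = 1" and s_root: "s ^ ell = 1" and ell_pos: "ell > 0"
    and coprime_3: "coprime ell 3" and r4_s4: "r ^ 4 \<noteq> s ^ 4"
begin

abbreviation "J \<equiv> relations_ideal r s ell"

interpretation J: two_sided_ideal J
  by standard (simp_all add: two_sided_ideal_relations)

section \<open>Invertible coefficients and the Serre relations\<close>

lemma scalar_cancel:
  fixes c :: 'k
  assumes "c \<noteq> 0" "scalar c * x \<in> J"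
  shows "x \<in> J"
proof -
  have "scalar (inverse c) * (scalar c * x) = x"
    using assms(1) by (simp flip: mult.assoc scalar_mult)
  then show ?thesis using J.lmult_mem[OF assms(2), of "scalar (inverse c)"] by simp
qed

text \<open>Both \<open>r + s\<close> and \<open>r^2 + s^2\<close> divide \<open>r^4 - s^4\<close>.
  If \<open>r^3 + s^3\<close> vanished, \<open>r / s\<close> would be a sixth root of unity; as its
  \<open>ell\<close>th power is 1 and 3 does not divide \<open>ell\<close>, this would force
  \<open>r^4 = s^4\<close>.\<close>

lemma nonzero_coefficients:
  "r \<noteq> 0" "s \<noteq> 0" "r + s \<noteq> 0" "r^2 + s^2 \<noteq> 0" "r^3 + s^3 \<noteq> 0"
proof -
  show r0: "r \<noteq> 0" and s0: "s \<noteq> 0"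
    using r_root s_root ell_pos by (auto simp: power_0_left)
  have factor: "r^4 - s^4 = (r - s) * (r + s) * (r^2 + s^2)"
    by (simp add: algebra_simps power2_eq_square power4_eq_xxxx)
  show "r + s \<noteq> 0" "r^2 + s^2 \<noteq> 0"
    using factor r4_s4 by auto
  show "r^3 + s^3 \<noteq> 0"
  proof
    assume sum0: "r^3 + s^3 = 0"
    define t where "t = r / s"
    have "(r^3)^2 = (s^3)^2"
      using sum0 by (simp add: add_eq_0_iff)
    then have t6: "t ^ 6 = 1"
      using s0 by (simp add: t_def power_divide flip: power_mult)
    have tl: "t ^ ell = 1"
      using r_root s_root by (simp add: t_def power_divide)
    have "\<not> 3 dvd ell"
      using coprime_3 coprime_common_divisor[of ell 3 3] by auto
    then have "ell = 3 * (ell div 3) + 1 \<or> ell = 3 * (ell div 3) + 2"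
      by presburger
    \<comment> \<open>Doubling covers both parities of \<open>ell\<close>: modulo 6 only the
      exponents 2 and 4 remain.\<close>
    then have "2 * ell = 6 * (ell div 3) + 2 \<or> 2 * ell = 6 * (ell div 3) + 4"
      by presburger
    moreover have "t ^ (2 * ell) = 1"
      using tl by (simp add: mult.commute[of 2] power_mult)
    moreover have "t ^ (6 * k + 2) = t^2" "t ^ (6 * k + 4) = t^4" for k
      by (simp_all only: power_add power_mult t6 power_one mult_1_left)
    ultimately have "t^2 = 1 \<or> t^4 = 1"
      by metis
    then have "t ^ 4 = 1"
      using power_mult[of t 2 2] by force
    then show False
      using r4_s4 s0 by (simp add: t_def power_divide)
  qed
qed

lemma serre_mem:
  "e N1 * e N2 ^ 2 - (scalar (r^3) + scalar (s^3)) * (e N2 * e N1 * e N2)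
     + scalar (r^3) * scalar (s^3) * (e N2 ^ 2 * e N1) \<in> J" (is "?abb \<in> J")
  "e N1 ^ 4 * e N2
     - (scalar (r^3) + scalar (s^3) + scalar (r * s^2) + scalar (r^2 * s)) * (e N1 ^ 3 * e N2 * e N1)
     + (scalar (r^3) * scalar (s^3) + scalar (r^3) * scalar (r * s^2) + scalar (r^3) * scalar (r^2 * s)
        + scalar (s^3) * scalar (r * s^2) + scalar (s^3) * scalar (r^2 * s)
        + scalar (r * s^2) * scalar (r^2 * s)) * (e N1 ^ 2 * e N2 * e N1 ^ 2)
     - (scalar (r^3) * scalar (s^3) * scalar (r * s^2) + scalar (r^3) * scalar (s^3) * scalar (r^2 * s)
        + scalar (r^3) * scalar (r * s^2) * scalar (r^2 * s)
        + scalar (s^3) * scalar (r * s^2) * scalar (r^2 * s)) * (e N1 * e N2 * e N1 ^ 3)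
     + scalar (r^3) * scalar (s^3) * scalar (r * s^2) * scalar (r^2 * s) * (e N2 * e N1 ^ 4) \<in> J"
    (is "?aaaab \<in> J")
proof -
  have serre: "a \<in> serre_rels r s \<Longrightarrow> a \<in> J" for a
    by (rule G2_rels_mem) (simp add: G2_rels_def)
  \<comment> \<open>Multiplication by \<open>(r * s)^3\<close> clears the negative powers and gives
    \<open>e N1 * e N2 ^ 2\<close> the coefficient 1.\<close>
  let ?S = "e N2 ^ 2 * e N1 - (r powi (-3) + s powi (-3)) \<bullet> (e N2 * e N1 * e N2)
        + ((r * s) powi (-3)) \<bullet> (e N1 * e N2 ^ 2)"
  have "?S \<in> J" by (rule serre) (simp add: serre_rels_def Let_def)
  then have S: "scalar ((r * s)^3) * ?S \<in> J" by (rule J.lmult_mem)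
  have coeffs: "(r * s)^3 * (r powi (-3) + s powi (-3)) = r^3 + s^3" "(r * s)^3 * (r * s) powi (-3) = 1"
    "(r * s)^3 = r^3 * s^3"
    using nonzero_coefficients(1,2) by (simp_all add: power_int_minus field_simps)
  have eq: "scalar ((r * s)^3) * ?S = scalar ((r * s)^3) * (e N2 ^ 2 * e N1)
      - scalar (r^3 + s^3) * (e N2 * e N1 * e N2) + scalar 1 * (e N1 * e N2 ^ 2)"
    unfolding smul_def right_diff_distrib distrib_left
    by (simp only: mult.assoc[symmetric] scalar_mult[symmetric] coeffs(1,2))
  from S[unfolded eq] show "?abb \<in> J" by (simp add: coeffs(3) scalar_add scalar_mult algebra_simps)
  have "e N1^4 * e N2
        - ((r + s) * (r^2 + s^2)) \<bullet> (e N1^3 * e N2 * e N1)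
        + (r * s * (r^2 + s^2) * (r^2 + r * s + s^2)) \<bullet> (e N1^2 * e N2 * e N1^2)
        - ((r * s)^3 * (r + s) * (r^2 + s^2)) \<bullet> (e N1 * e N2 * e N1^3)
        + ((r * s)^6) \<bullet> (e N2 * e N1^4) \<in> J"
    by (rule serre) (simp add: serre_rels_def Let_def)
  moreover have
    \<comment> \<open>The four elementary symmetric functions of \<open>r^3\<close>,
      \<open>s^3\<close>, \<open>r * s^2\<close>, \<open>r^2 * s\<close>.\<close>
    "(r + s) * (r^2 + s^2) = r^3 + s^3 + r * s^2 + r^2 * s"
    "r * s * (r^2 + s^2) * (r^2 + r * s + s^2) = r^3 * s^3 + r^3 * (r * s^2) + r^3 * (r^2 * s)
       + s^3 * (r * s^2) + s^3 * (r^2 * s) + r * s^2 * (r^2 * s)"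
    "(r * s)^3 * (r + s) * (r^2 + s^2) = r^3 * s^3 * (r * s^2) + r^3 * s^3 * (r^2 * s)
       + r^3 * (r * s^2) * (r^2 * s) + s^3 * (r * s^2) * (r^2 * s)"
    "(r * s)^6 = r^3 * s^3 * (r * s^2) * (r^2 * s)"
    by (simp_all add: algebra_simps power2_eq_square power3_eq_cube eval_nat_numeral)
  ultimately show "?aaaab \<in> J"
    by (simp only: smul_def scalar_add scalar_mult)
qed

interpretation G: serre_g2 J "scalar (r^3)" "scalar (s^3)" "scalar (r * s^2)" "scalar (r^2 * s)" "e N1" "e N2"
proof
  show "x * c = c * x" if "c \<in> {scalar (r^3), scalar (s^3), scalar (r * s^2), scalar (r^2 * s)}" for c x :: "'k free_G2"
    using that by (auto simp: scalar_central)
  show "scalar (r * s^2) * scalar (r^2 * s) = scalar (r^3) * scalar (s^3)"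
    "scalar (r * s^2) * scalar (r * s^2) = scalar (s^3) * scalar (r^2 * s)"
    "scalar (r^2 * s) * scalar (r^2 * s) = scalar (r^3) * scalar (r * s^2)"
    by (simp_all flip: scalar_mult add: power2_eq_square power3_eq_cube mult_ac)
next
  fix c x :: "'k free_G2"
  assume c: "c \<in> {scalar (r^3), scalar (s^3), scalar (r^3) + scalar (s^3), scalar (r * s^2) + scalar (r^2 * s),
      scalar (r * s^2) * scalar (r * s^2) + scalar (r^2 * s) * scalar (r^2 * s)}" and "c * x \<in> J"
  \<comment> \<open>These factorizations reduce the remaining two cancellable constants to
    \<open>r\<close>, \<open>s\<close>, \<open>r + s\<close> and \<open>r^2 + s^2\<close>.\<close>
  have "r * s^2 + r^2 * s = r * s * (r + s)"
    "r * s^2 * (r * s^2) + r^2 * s * (r^2 * s) = (r * s)^2 * (r^2 + s^2)"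
    by (simp_all add: algebra_simps power2_eq_square power3_eq_cube eval_nat_numeral)
  then have "c \<in> scalar ` {r^3, s^3, r^3 + s^3, r * s * (r + s), (r * s)^2 * (r^2 + s^2)}"
    using c unfolding scalar_add[symmetric] scalar_mult[symmetric] by simp
  then obtain \<gamma> where "c = scalar \<gamma>" "\<gamma> \<noteq> 0"
    using nonzero_coefficients by auto
  then show "x \<in> J" using scalar_cancel \<open>c * x \<in> J\<close> by simp
qed (fact serre_mem)+

lemma root_vectors_eq:
  "G.ab = E12 r s" "G.aab = E112 r s" "G.aaab = E1112 r s" "G.aabab = E11212 r s"
proof -
  show ab: "G.ab = E12 r s"
    by (simp only: G.ab_def E12_def smul_def)
  show aab: "G.aab = E112 r s"
    by (simp only: G.aab_def E112_def smul_def ab)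
  show "G.aaab = E1112 r s" "G.aabab = E11212 r s"
    by (simp_all only: G.aaab_def G.aabab_def E1112_def E11212_def smul_def ab aab)
qed

lemma elt_x_eq: "elt_x r s ell = G.root_product (ell - 1)"
  by (simp add: elt_x_def G.root_product_def root_vectors_eq E1_def E2_def)

lemma e_elt_x: "e i * elt_x r s ell \<in> J" and elt_x_e: "elt_x r s ell * e i \<in> J"
proof -
  \<comment> \<open>Since \<open>ell > 0\<close>, the exponent is \<open>ell\<close>, so these are
    defining relations of the restricted quotient.\<close>
  have "c ^ Suc (ell - 1) \<in> J" if "c \<in> {e N1, e N2, G.ab, G.aab, G.aaab, G.aabab}" for c
    using that ell_pos unfolding root_vectors_eq
    by (intro restricted_rels_mem UnI1) (auto simp: root_vectors_def E1_def E2_def)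
  note annihilates = G.root_product_left_annihilates[OF this] G.root_product_right_annihilates[OF this]
  show "e i * elt_x r s ell \<in> J" "elt_x r s ell * e i \<in> J"
    unfolding elt_x_eq using annihilates by (cases i; simp)+
qed

section \<open>The group-likes and their action on the \<open>e i\<close>\<close>

lemma torus_commute:
  assumes "x \<in> range w \<union> range w_inv" "y \<in> range w \<union> range w_inv"
  shows "x * y - y * x \<in> J"
proof (rule G2_rels_mem)
  have "x * y - y * x \<in> torus_rels"
    unfolding torus_rels_def Let_def using assms by blast
  then show "x * y - y * x \<in> G2_rels r s" by (simp add: G2_rels_def)
qed

lemma w_w_inv: "w j * w_inv j - 1 \<in> J"
  by (rule G2_rels_mem) (auto simp: G2_rels_def torus_rels_def)

text \<open>The presentation lists the inverse on the right; commutativity of the torus gives it on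
  the left.\<close>

lemma w_inv_w: "w_inv j * w j - 1 \<in> J"
proof -
  have "(w j * w_inv j - 1) - (w j * w_inv j - w_inv j * w j) \<in> J"
    by (intro J.diff_mem w_w_inv torus_commute) auto
  then show ?thesis by simp
qed

lemma w_e: "w j * e i - scalar (pairing r s i j) * (e i * w j) \<in> J"
proof -
  have "w j * e i * w_inv j - pairing r s i j \<bullet> e i \<in> J"
    by (rule G2_rels_mem) (auto simp: G2_rels_def weight_rels_def)
  then have "(w j * e i * w_inv j - pairing r s i j \<bullet> e i) * w j - w j * e i * (w_inv j * w j - 1) \<in> J"
    by (simp add: J.mem_intros w_inv_w)
  then show ?thesis
    by (simp add: smul_def algebra_simps)
qed

lemma pairing_nonzero: "pairing r s i j \<noteq> 0"
  using nonzero_coefficients(1,2) by (cases i; cases j) simp_all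

text \<open>Moving \<open>e i\<close> to the right through the monomials of \<open>t\<close> changes
  it by non-zero scalars only, until it meets \<open>x\<close> and is annihilated.\<close>

lemma e_elt_t_elt_x: "e i * (elt_t ell * elt_x r s ell) \<in> J"
proof -
  have push: "\<forall>x\<in>{e i}. x * (w j * z) \<in> J" if "\<forall>x\<in>{e i}. x * z \<in> J" for j and z :: "'k free_G2"
  proof -
    have "w j * (e i * z) - (w j * e i - scalar (pairing r s i j) * (e i * w j)) * z \<in> J"
      using that by (simp add: J.mem_intros w_e)
    then have "scalar (pairing r s i j) * (e i * (w j * z)) \<in> J"
      by (simp add: algebra_simps)
    \<comment> \<open>\<open>w_e\<close> moves \<open>e i\<close> to the left past
      \<open>w j\<close>; its use in the opposite direction divides by the pairing.\<close>
    from scalar_cancel[OF pairing_nonzero this] show ?thesis by simp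
  qed
  have "e i * (w N1 ^ k * (w N2 ^ l * elt_x r s ell)) \<in> J" for k l
  proof -
    have "\<forall>x\<in>{e i}. x * elt_x r s ell \<in> J"
      by (simp add: e_elt_x)
    then have "\<forall>x\<in>{e i}. x * (w N2 ^ l * elt_x r s ell) \<in> J"
      by (rule J.left_annihilated_power[rotated]) (rule push)
    then have "\<forall>x\<in>{e i}. x * (w N1 ^ k * (w N2 ^ l * elt_x r s ell)) \<in> J"
      by (rule J.left_annihilated_power[rotated]) (rule push)
    then show ?thesis by simp
  qed
  then have "(\<Sum>k<ell. \<Sum>l<ell. e i * (w N1 ^ k * (w N2 ^ l * elt_x r s ell))) \<in> J"
    by (intro J.sum_mem)
  also have "(\<Sum>k<ell. \<Sum>l<ell. e i * (w N1 ^ k * (w N2 ^ l * elt_x r s ell)))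
      = e i * (elt_t ell * elt_x r s ell)"
    by (subst sum.swap) (simp add: elt_t_def sum_distrib_left sum_distrib_right mult.assoc)
  finally show ?thesis .
qed

lemma elt_x_elt_t_e: "elt_x r s ell * elt_t ell * e i \<in> J"
proof -
  have push: "\<forall>x\<in>{e i}. z * w j * x \<in> J" if "\<forall>x\<in>{e i}. z * x \<in> J" for j and z :: "'k free_G2"
  proof -
    have "z * (w j * e i - scalar (pairing r s i j) * (e i * w j))
        + scalar (pairing r s i j) * (z * e i * w j) \<in> J"
      using that by (simp add: J.mem_intros w_e)
    then show ?thesis
      by (simp add: algebra_simps scalar_left_central[of z])
  qed
  have "elt_x r s ell * w N1 ^ k * w N2 ^ l * e i \<in> J" for k l
  proof -
    have "\<forall>x\<in>{e i}. elt_x r s ell * x \<in> J"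
      by (simp add: elt_x_e)
    then have "\<forall>x\<in>{e i}. elt_x r s ell * w N1 ^ k * x \<in> J"
      by (rule J.right_annihilated_power[rotated]) (rule push)
    then have "\<forall>x\<in>{e i}. elt_x r s ell * w N1 ^ k * w N2 ^ l * x \<in> J"
      by (rule J.right_annihilated_power[rotated]) (rule push)
    then show ?thesis by simp
  qed
  then have "(\<Sum>k<ell. \<Sum>l<ell. elt_x r s ell * w N1 ^ k * w N2 ^ l * e i) \<in> J"
    by (intro J.sum_mem)
  also have "(\<Sum>k<ell. \<Sum>l<ell. elt_x r s ell * w N1 ^ k * w N2 ^ l * e i)
      = elt_x r s ell * elt_t ell * e i"
    by (subst sum.swap) (simp add: elt_t_def sum_distrib_left sum_distrib_right mult.assoc)
  finally show ?thesis .
qed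

text \<open>The geometric sum telescopes to \<open>w j ^ ell - 1\<close>, a relation of the
  restricted quotient.\<close>

lemma w_power_sum:
  "w j * (\<Sum>k<ell. w j ^ k) - (\<Sum>k<ell. w j ^ k) \<in> J"
  "(\<Sum>k<ell. w j ^ k) * w j - (\<Sum>k<ell. w j ^ k) \<in> J"
proof -
  have "w j * (\<Sum>k<m. w j ^ k) - (\<Sum>k<m. w j ^ k) = (w j ^ m - 1 :: 'k free_G2)"
    "(\<Sum>k<m. w j ^ k) * w j - (\<Sum>k<m. w j ^ k) = (w j ^ m - 1 :: 'k free_G2)" for m
    by (induction m) (simp_all add: algebra_simps power_commutes)
  moreover have "w j ^ ell - 1 \<in> J"
    by (rule restricted_rels_mem) auto
  ultimately show "w j * (\<Sum>k<ell. w j ^ k) - (\<Sum>k<ell. w j ^ k) \<in> J"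
    "(\<Sum>k<ell. w j ^ k) * w j - (\<Sum>k<ell. w j ^ k) \<in> J"
    by simp_all
qed

text \<open>Lets a group-like reach the factor of \<open>t\<close> that absorbs it:
  \<open>w N2\<close> from the left, \<open>w N1\<close> from the right.\<close>

lemma w_power_sum_commute: "w j * (\<Sum>k<ell. w i ^ k) - (\<Sum>k<ell. w i ^ k) * w j \<in> J"
proof -
  have "w j * w i ^ k - w i ^ k * w j \<in> J" for k
  proof (induction k)
    case (Suc k)
    then have "(w j * w i ^ k - w i ^ k * w j) * w i + w i ^ k * (w j * w i - w i * w j) \<in> J"
      by (simp add: J.mem_intros torus_commute)
    then show ?case
      by (simp add: algebra_simps power_Suc2 del: power_Suc)
  qed simp
  then have "(\<Sum>k<ell. w j * w i ^ k - w i ^ k * w j) \<in> J"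
    by (intro J.sum_mem)
  then show ?thesis by (simp add: sum_subtractf sum_distrib_left sum_distrib_right)
qed

lemma w_elt_t: "w j * elt_t ell - elt_t ell \<in> J"
proof (cases j)
  case N1
  have "(w N1 * (\<Sum>k<ell. w N1 ^ k) - (\<Sum>k<ell. w N1 ^ k)) * (\<Sum>k<ell. w N2 ^ k) \<in> J"
    by (intro J.rmult_mem w_power_sum)
  then show ?thesis by (simp add: N1 elt_t_def algebra_simps)
next
  case N2
  have "(w N2 * (\<Sum>k<ell. w N1 ^ k) - (\<Sum>k<ell. w N1 ^ k) * w N2) * (\<Sum>k<ell. w N2 ^ k)
      + (\<Sum>k<ell. w N1 ^ k) * (w N2 * (\<Sum>k<ell. w N2 ^ k) - (\<Sum>k<ell. w N2 ^ k)) \<in> J"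
    by (intro J.add_mem J.rmult_mem J.lmult_mem w_power_sum w_power_sum_commute)
  then show ?thesis by (simp add: N2 elt_t_def algebra_simps)
qed

lemma elt_t_w: "elt_t ell * w j - elt_t ell \<in> J"
proof (cases j)
  case N2
  have "(\<Sum>k<ell. w N1 ^ k) * ((\<Sum>k<ell. w N2 ^ k) * w N2 - (\<Sum>k<ell. w N2 ^ k)) \<in> J"
    by (intro J.lmult_mem w_power_sum)
  then show ?thesis by (simp add: N2 elt_t_def algebra_simps)
next
  case N1
  have "((\<Sum>k<ell. w N1 ^ k) * w N1 - (\<Sum>k<ell. w N1 ^ k)) * (\<Sum>k<ell. w N2 ^ k)
      - (\<Sum>k<ell. w N1 ^ k) * (w N1 * (\<Sum>k<ell. w N2 ^ k) - (\<Sum>k<ell. w N2 ^ k) * w N1) \<in> J"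
    by (intro J.diff_mem J.rmult_mem J.lmult_mem w_power_sum w_power_sum_commute)
  then show ?thesis by (simp add: N1 elt_t_def algebra_simps)
qed

section \<open>The action of the Borel generators on the candidate integrals\<close>

lemma gen_elt_t_elt_x:
  assumes "g \<in> borel_gens"
  shows "gen g * (elt_t ell * elt_x r s ell) - scalar (counit_gen g) * (elt_t ell * elt_x r s ell) \<in> J"
proof -
  let ?y = "elt_t ell * elt_x r s ell"
  have w: "w j * ?y - ?y \<in> J" for j
    using J.rmult_mem[OF w_elt_t, of j "elt_x r s ell"] by (simp add: algebra_simps)
  \<comment> \<open>Applying \<open>w_inv j\<close> to the invariance of \<open>?y\<close> under
    \<open>w j\<close> gives its invariance under \<open>w_inv j\<close>.\<close>
  have "(w_inv j * w j - 1) * ?y - w_inv j * (w j * ?y - ?y) \<in> J" for j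
    by (intro J.diff_mem J.rmult_mem J.lmult_mem w_inv_w w)
  then have "w_inv j * ?y - ?y \<in> J" for j
    by (simp add: algebra_simps)
  with w e_elt_t_elt_x show ?thesis
    using assms by (auto simp: e_def w_def w_inv_def)
qed

lemma elt_x_elt_t_gen:
  assumes "g \<in> borel_gens"
  shows "elt_x r s ell * elt_t ell * gen g - scalar (counit_gen g) * (elt_x r s ell * elt_t ell) \<in> J"
proof -
  let ?y = "elt_x r s ell * elt_t ell"
  have w: "?y * w j - ?y \<in> J" for j
    using J.lmult_mem[OF elt_t_w, of "elt_x r s ell" j] by (simp add: algebra_simps)
  have "?y * (w j * w_inv j - 1) - (?y * w j - ?y) * w_inv j \<in> J" for j
    by (intro J.diff_mem J.rmult_mem J.lmult_mem w_w_inv w)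
  then have "?y * w_inv j - ?y \<in> J" for j
    by (simp add: algebra_simps)
  with w elt_x_elt_t_e show ?thesis
    using assms by (auto simp: e_def w_def w_inv_def)
qed

text \<open>Every Borel element is the class of a combination of Borel words, on which the counit is
  the character given by its values on letters; the two character lemmas then extend the action of
  the generators.\<close>

lemma integrals:
  "left_integral (borel r s ell) (\<lambda>c. to_u r s ell (scalar c)) (induced_counit (to_u r s ell))
     (to_u r s ell (elt_t ell * elt_x r s ell))"
  "right_integral (borel r s ell) (\<lambda>c. to_u r s ell (scalar c)) (induced_counit (to_u r s ell))
     (to_u r s ell (elt_x r s ell * elt_t ell))"
proof -
  interpret S: submonoid_support "words_over borel_gens" "TYPE('k)"
    by (rule submonoid_words_over)
  have mult_borel: "mult (borel r s ell) = mult (u_G2 r s ell)"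
    by (simp add: borel_def)
  have "a * (elt_t ell * elt_x r s ell) - scalar (counit a) * (elt_t ell * elt_x r s ell) \<in> J"
    if "a \<in> supported (words_over borel_gens)" for a
    unfolding counit_eq_char_sum
    by (rule character_left[OF J.two_sided_ideal_axioms gen_elt_t_elt_x that])
  then show "left_integral (borel r s ell) (\<lambda>c. to_u r s ell (scalar c)) (induced_counit (to_u r s ell))
     (to_u r s ell (elt_t ell * elt_x r s ell))"
    unfolding left_integral_def carrier_borel mult_borel
    by (auto simp: induced_counit_to_u[OF ell_pos] to_u_eq_iff elt_t_supported elt_x_supported
        simp flip: to_u_mult intro!: imageI S.supported_mult)
  have "elt_x r s ell * elt_t ell * a - scalar (counit a) * (elt_x r s ell * elt_t ell) \<in> J"
    if "a \<in> supported (words_over borel_gens)" for a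
    unfolding counit_eq_char_sum
    by (rule character_right[OF J.two_sided_ideal_axioms elt_x_elt_t_gen that])
  then show "right_integral (borel r s ell) (\<lambda>c. to_u r s ell (scalar c)) (induced_counit (to_u r s ell))
     (to_u r s ell (elt_x r s ell * elt_t ell))"
    unfolding right_integral_def carrier_borel mult_borel
    by (auto simp: induced_counit_to_u[OF ell_pos] to_u_eq_iff elt_t_supported elt_x_supported
        simp flip: to_u_mult intro!: imageI S.supported_mult)
qed

end

theorem proposition6p2:
  fixes r s :: "'k::field_char_0" and d d' ell :: nat
  assumes "primitive_root_of_unity d r"
    and "primitive_root_of_unity d' s"
    and "ell = lcm d d'"
    and "\<exists>\<zeta>::'k. primitive_root_of_unity ell \<zeta>"
    and "coprime ell 3"
    and "r ^ 3 \<noteq> s ^ 3"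
    and "r ^ 4 \<noteq> s ^ 4"
  shows "let \<pi> = to_u r s ell;
             \<bb> = borel r s ell;
             \<epsilon> = induced_counit \<pi>;
             \<eta> = (\<lambda>c. \<pi> (scalar c));
             t = \<pi> (elt_t ell);
             x = \<pi> (elt_x r s ell)
         in left_integral \<bb> \<eta> \<epsilon> (t \<otimes>\<^bsub>u_G2 r s ell\<^esub> x)
            \<and> right_integral \<bb> \<eta> \<epsilon> (x \<otimes>\<^bsub>u_G2 r s ell\<^esub> t)"
proof -
  have d: "d > 0" "r ^ d = 1" "d' > 0" "s ^ d' = 1"
    using assms(1,2) by (auto simp: primitive_root_of_unity_def)
  have "ell > 0"
    using d assms(3) by (simp add: lcm_pos_nat)
  moreover have "r ^ ell = 1" "s ^ ell = 1"
    using d unfolding assms(3) by (metis dvd_lcm1 dvdE power_mult power_one, metis dvd_lcm2 dvdE power_mult power_one)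
  ultimately show ?thesis
    using integrals[of r ell s] assms(5,7) by (simp add: Let_def to_u_mult)
qed

end
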